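(* Let $\mu=(\mu_1,\dots,\mu_n)$ with all $\mu_i\ge1$ and $N=\sum_i\mu_i$. For $A\in W_\mu$ let $\mathcal L=\mathbb C[x]^n$, let $\mathcal L_A\subset\mathcal L$ be the $\mathbb C[x]$-lattice generated by the columns of $A$, and let $\mathbf{MVy}(A)\in\mathfrak{gl}_N$ be the matrix of multiplication by $x$ on $\mathcal L/\mathcal L_A$ with respect to the basis $\{\vec v_{i,k}:1\le i\le n,\ 0\le k\le\mu_i-1\}$ (ordered lexicographically by $(i,k)$) defined in the context. Then $A\mapsto\mathbf{MVy}(A)$ is an isomorphism of algebraic varieties $\mathbf{MVy}:W_\mu\to S_\mu$; in particular the Jordan type of multiplication by $x$ on $\mathcal L/\mathcal L_A$ equals that of $\mathbf{MVy}(A)$.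
   Context: $W_\mu$ (generalized affine Grassmannian slice): the set of matrices $A=(a_{i,j})\in Mat_{n\times n}(\mathbb C[x])$ lying in $U_1\,x^{\mu}\,T_1\,V_1$, where $x^\mu=\mathrm{diag}(x^{\mu_1},\dots,x^{\mu_n})$, $U_1$ is the group of upper-triangular unipotent matrices whose off-diagonal entries lie in $x^{-1}\mathbb C[[x^{-1}]]$, $T_1$ the diagonal matrices with entries in $1+x^{-1}\mathbb C[[x^{-1}]]$, and $V_1$ the transpose of $U_1$. $S_\mu$: the set of $N\times N$ matrices which, divided into $n\times n$ blocks with $(i,j)$ block of size $\mu_i\times\mu_j$, satisfy: for $i>j$ all columns of the $(i,j)$ block except the last vanish; for $i<j$ all rows of the $(i,j)$ block except the first vanish; the $(i,i)$ block is a companion matrix (ones on the subdiagonal, arbitrary last column, zeros elsewhere). Coefficients. Write $a_{i,j}=-\sum_{l\ge0}a_{i,j}^{(l)}x^l$. Define recursively $b_{i,j}^{(l)}$ for $0\le l\le\mu_{\max(i,j)}-1$ (and $b_{i,j}^{(l)}=0$ for other $l$): for $i\ge j$, $$b_{i,j}^{(l)}=a_{i,j}^{(l)}+\sum_{k>i}\ \sum_{p+q=\mu_k+l}b_{k,j}^{(p)}b_{i,k}^{(q)},$$ and for $i<j$, $$b_{i,j}^{(l)}=a_{i,j}^{(l)}+\sum_{j\le k\le n}\ \sum_{p+q=\mu_k+l}b_{k,j}^{(p)}b_{i,k}^{(q)}.$$ (The recursion runs by descending indices and descending $l$.) Basis. With $\vec e_1,\dots,\vec e_n$ the standard basis of $\mathbb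 C[x]^n$: $\vec v_{i,0}=\vec e_i$ and $\vec v_{i,k}=x\vec v_{i,k-1}-\sum_{j<i}b_{j,i}^{(\mu_i-k)}\vec v_{j,0}$ for $1\le k\le\mu_i-1$. The images of these vectors form a $\mathbb C$-basis of $\mathcal L/\mathcal L_A$. *)

theory Defs
  imports
    "HOL-Computational_Algebra.Formal_Laurent_Series"
    "HOL-Algebra.AbelCoset"
    "Jordan_Normal_Form.Jordan_Normal_Form"
    "Jordan_Normal_Form.VS_Connect"
begin

text \<open>
  All indices are shifted to start at 0: \<open>mu = [mu ! 0, \<dots>, mu ! (n - 1)]\<close> with \<open>n = length mu\<close>
  and \<open>N = sum_list mu\<close>.
\<close>

section \<open>The slice \<open>W\<^sub>\<mu>\<close>\<close>

text \<open>
  The field of Laurent series in \<open>x\<inverse>\<close> is modelled by the type of formal Laurent series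
  whose variable \<^const>\<open>fls_X\<close> stands for \<open>x\<inverse>\<close>, so \<open>x\<close> itself is \<^const>\<open>fls_X_inv\<close>.
\<close>

definition laurent_of_poly :: "complex poly \<Rightarrow> complex fls" where
  "laurent_of_poly p = poly (map_poly fls_const p) fls_X_inv"

definition xinv_series :: "complex fls set" where
  "xinv_series = {fls_X * fps_to_fls g | g. True}"

definition U1 :: "nat \<Rightarrow> complex fls mat set" where
  "U1 n = {U \<in> carrier_mat n n.
     (\<forall>i<n. U $$ (i, i) = 1) \<and>
     (\<forall>i<n. \<forall>j<i. U $$ (i, j) = 0) \<and>
     (\<forall>j<n. \<forall>i<j. U $$ (i, j) \<in> xinv_series)}"

definition T1 :: "nat \<Rightarrow> complex fls mat set" where
  "T1 n = {mat_diag n t | t. \<forall>i<n. t i - 1 \<in> xinv_series}"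

definition V1 :: "nat \<Rightarrow> complex fls mat set" where
  "V1 n = transpose_mat ` U1 n"

definition x_pow_mu :: "nat list \<Rightarrow> complex fls mat" where
  "x_pow_mu mu = mat_diag (length mu) (\<lambda>i. fls_X_inv ^ (mu ! i))"

definition W_slice :: "nat list \<Rightarrow> complex poly mat set" where
  "W_slice mu = {A \<in> carrier_mat (length mu) (length mu).
     \<exists>U \<in> U1 (length mu). \<exists>T \<in> T1 (length mu). \<exists>V \<in> V1 (length mu).
       map_mat laurent_of_poly A = U * x_pow_mu mu * T * V}"

section \<open>The slice \<open>S\<^sub>\<mu>\<close>\<close>

definition offset :: "nat list \<Rightarrow> nat \<Rightarrow> nat" where
  "offset mu i = sum_list (take i mu)"

definition block :: "nat list \<Rightarrow> complex mat \<Rightarrow> nat \<Rightarrow> nat \<Rightarrow> complex mat" where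
  "block mu M i j =
     mat (mu ! i) (mu ! j) (\<lambda>(k, m). M $$ (offset mu i + k, offset mu j + m))"

definition is_companion :: "complex mat \<Rightarrow> bool" where
  "is_companion C \<longleftrightarrow> dim_row C = dim_col C \<and>
     (\<forall>k < dim_row C. \<forall>m < dim_col C - 1. C $$ (k, m) = (if k = m + 1 then 1 else 0))"

definition S_slice :: "nat list \<Rightarrow> complex mat set" where
  "S_slice mu = {M \<in> carrier_mat (sum_list mu) (sum_list mu).
     (\<forall>i < length mu. \<forall>j < length mu.
        (j < i \<longrightarrow> (\<forall>k < mu ! i. \<forall>m < mu ! j - 1. block mu M i j $$ (k, m) = 0)) \<and>
        (i < j \<longrightarrow> (\<forall>k < mu ! i. \<forall>m < mu ! j. 0 < k \<longrightarrow> block mu M i j $$ (k, m) = 0)) \<and>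
        (i = j \<longrightarrow> is_companion (block mu M i j)))}"

section \<open>The coefficients \<open>b\<close> and the vectors \<open>v\<close>\<close>

definition a_coeff :: "complex poly mat \<Rightarrow> nat \<Rightarrow> nat \<Rightarrow> nat \<Rightarrow> complex" where
  "a_coeff A i j l = - poly.coeff (A $$ (i, j)) l"

text \<open>
  The sum over \<open>p + q = mu ! k + l\<close> is written as a sum over \<open>p\<close>. Since \<open>max k j = k\<close> for all \<open>k\<close>
  involved, the factor with upper index \<open>p\<close> vanishes unless \<open>p < mu ! k\<close>; restricting to these \<open>p\<close>
  loses nothing and gives \<open>q > l\<close>, which makes the recursion well-founded.
\<close>

function b_coeff :: "nat list \<Rightarrow> complex poly mat \<Rightarrow> nat \<Rightarrow> nat \<Rightarrow> nat \<Rightarrow> complex" where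
  "b_coeff mu A i j l =
     (if i < length mu \<and> j < length mu \<and> l < mu ! (max i j) then
        if j \<le> i then
          a_coeff A i j l +
            (\<Sum>k\<in>{i<..<length mu}. \<Sum>p\<in>{..<mu ! k}.
               b_coeff mu A k j p * b_coeff mu A i k (mu ! k + l - p))
        else
          a_coeff A i j l +
            (\<Sum>k\<in>{j..<length mu}. \<Sum>p\<in>{..<mu ! k}.
               b_coeff mu A k j p * b_coeff mu A i k (mu ! k + l - p))
      else 0)"
  by pat_completeness auto
termination
proof (relation "measures
    [\<lambda>(mu, A, i, j, l). length mu - max i j,
     \<lambda>(mu, A, i, j, l). if j \<le> i then 0 else 1,
     \<lambda>(mu, A, i, j, l). mu ! (max i j) - l]", goal_cases)
  case (5 mu A i j l k p)
  then show ?case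
    by (cases "k = j") auto
qed (auto simp: max_def)

declare b_coeff.simps [simp del]

fun v_vec :: "nat list \<Rightarrow> complex poly mat \<Rightarrow> nat \<Rightarrow> nat \<Rightarrow> complex poly vec" where
  "v_vec mu A i 0 = unit_vec (length mu) i"
| "v_vec mu A i (Suc k) = [:0, 1:] \<cdot>\<^sub>v v_vec mu A i k -
     finsum_vec TYPE(complex poly) (length mu)
       (\<lambda>j. [:b_coeff mu A j i (mu ! i - Suc k):] \<cdot>\<^sub>v v_vec mu A j 0) {..<i}"

definition v_list :: "nat list \<Rightarrow> complex poly mat \<Rightarrow> complex poly vec list" where
  "v_list mu A = concat (map (\<lambda>i. map (v_vec mu A i) [0..<mu ! i]) [0..<length mu])"

section \<open>The quotient \<open>\<L>/\<L>\<^sub>A\<close> and multiplication by \<open>x\<close>\<close>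

abbreviation poly_space :: "nat \<Rightarrow> (complex poly, complex poly vec) module" where
  "poly_space n \<equiv> module_vec TYPE(complex poly) n"

definition lattice_of :: "complex poly mat \<Rightarrow> complex poly vec set" where
  "lattice_of A = {A *\<^sub>v f | f. f \<in> carrier_vec (dim_col A)}"

definition coset_of :: "complex poly mat \<Rightarrow> complex poly vec \<Rightarrow> complex poly vec set" where
  "coset_of A u = lattice_of A +>\<^bsub>poly_space (dim_row A)\<^esub> u"

text \<open>The quotient as a complex vector space; the fields \<open>mult\<close> and \<open>one\<close> of the record are not used.\<close>

definition quot_space :: "complex poly mat \<Rightarrow> (complex, complex poly vec set) module" where
  "quot_space A = \<lparr>
     carrier = a_rcosets\<^bsub>poly_space (dim_row A)\<^esub> (lattice_of A),
     mult = undefined,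
     one = undefined,
     zero = lattice_of A,
     add = set_add (poly_space (dim_row A)),
     smult = (\<lambda>c X. \<Union>u\<in>X. coset_of A ([:c:] \<cdot>\<^sub>v u))\<rparr>"

definition mult_x :: "complex poly mat \<Rightarrow> complex poly vec set \<Rightarrow> complex poly vec set" where
  "mult_x A X = (\<Union>u\<in>X. coset_of A ([:0, 1:] \<cdot>\<^sub>v u))"

section \<open>Matrices and Jordan forms of linear operators\<close>

definition ordered_basis :: "('k :: field, 'v) module \<Rightarrow> 'v list \<Rightarrow> bool" where
  "ordered_basis V bs \<longleftrightarrow>
     vectorspace class_ring V \<and> distinct bs \<and> vectorspace.basis class_ring V (set bs)"

definition is_matrix_of ::
  "('k :: field, 'v) module \<Rightarrow> 'v list \<Rightarrow> ('v \<Rightarrow> 'v) \<Rightarrow> 'k mat \<Rightarrow> bool" where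
  "is_matrix_of V bs T M \<longleftrightarrow>
     M \<in> carrier_mat (length bs) (length bs) \<and>
     (\<forall>c < length bs. T (bs ! c) = (\<Oplus>\<^bsub>V\<^esub>r\<in>{..<length bs}. M $$ (r, c) \<odot>\<^bsub>V\<^esub> (bs ! r)))"

text \<open>
  The operator analogue of \<^const>\<open>jordan_nf\<close>: \<open>n_as\<close> lists the sizes and eigenvalues of the
  Jordan blocks.
\<close>

definition operator_jordan_nf ::
  "('k :: field, 'v) module \<Rightarrow> ('v \<Rightarrow> 'v) \<Rightarrow> (nat \<times> 'k) list \<Rightarrow> bool" where
  "operator_jordan_nf V T n_as \<longleftrightarrow>
     0 \<notin> fst ` set n_as \<and>
     (\<exists>bs. ordered_basis V bs \<and> is_matrix_of V bs T (jordan_matrix n_as))"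

definition quot_basis :: "nat list \<Rightarrow> complex poly mat \<Rightarrow> complex poly vec set list" where
  "quot_basis mu A = map (coset_of A) (v_list mu A)"

definition MVy :: "nat list \<Rightarrow> complex poly mat \<Rightarrow> complex mat" where
  "MVy mu A = (THE M. is_matrix_of (quot_space A) (quot_basis mu A) (mult_x A) M)"

section \<open>Affine algebraic varieties\<close>

text \<open>
  An affine space is the space of functions from a finite index set \<open>I\<close> to the complex numbers,
  extended by 0 outside \<open>I\<close>. A variety is a Zariski closed subset (not assumed irreducible).
\<close>

inductive polynomial_fun :: "(('i \<Rightarrow> complex) \<Rightarrow> complex) \<Rightarrow> bool" where
  const: "polynomial_fun (\<lambda>z. c)"
| coord: "polynomial_fun (\<lambda>z. z i)"
| add: "polynomial_fun f \<Longrightarrow> polynomial_fun g \<Longrightarrow> polynomial_fun (\<lambda>z. f z + g z)"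
| mult: "polynomial_fun f \<Longrightarrow> polynomial_fun g \<Longrightarrow> polynomial_fun (\<lambda>z. f z * g z)"

definition zariski_closed :: "('i \<Rightarrow> complex) set \<Rightarrow> bool" where
  "zariski_closed Z \<longleftrightarrow> (\<exists>I F. finite I \<and> (\<forall>f\<in>F. polynomial_fun f) \<and>
     Z = {z. (\<forall>i. i \<notin> I \<longrightarrow> z i = 0) \<and> (\<forall>f\<in>F. f z = 0)})"

text \<open>A set of points of an arbitrary type is viewed as a variety via coordinates \<open>\<kappa>\<close>.\<close>

definition affine_variety :: "('p \<Rightarrow> 'i \<Rightarrow> complex) \<Rightarrow> 'p set \<Rightarrow> bool" where
  "affine_variety \<kappa> X \<longleftrightarrow> inj_on \<kappa> X \<and> zariski_closed (\<kappa> ` X)"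

definition regular_map ::
  "('p \<Rightarrow> 'i \<Rightarrow> complex) \<Rightarrow> 'p set \<Rightarrow> ('q \<Rightarrow> 'j \<Rightarrow> complex) \<Rightarrow> 'q set \<Rightarrow> ('p \<Rightarrow> 'q) \<Rightarrow> bool" where
  "regular_map \<kappa> X \<kappa>' Y f \<longleftrightarrow> f ` X \<subseteq> Y \<and>
     (\<forall>j. \<exists>g. polynomial_fun g \<and> (\<forall>P\<in>X. \<kappa>' (f P) j = g (\<kappa> P)))"

definition variety_isomorphism ::
  "('p \<Rightarrow> 'i \<Rightarrow> complex) \<Rightarrow> 'p set \<Rightarrow> ('q \<Rightarrow> 'j \<Rightarrow> complex) \<Rightarrow> 'q set \<Rightarrow> ('p \<Rightarrow> 'q) \<Rightarrow> bool" where
  "variety_isomorphism \<kappa> X \<kappa>' Y f \<longleftrightarrow>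
     affine_variety \<kappa> X \<and> affine_variety \<kappa>' Y \<and> regular_map \<kappa> X \<kappa>' Y f \<and>
     (\<exists>g. regular_map \<kappa>' Y \<kappa> X g \<and> (\<forall>P\<in>X. g (f P) = P) \<and> (\<forall>Q\<in>Y. f (g Q) = Q))"

definition poly_mat_coords :: "complex poly mat \<Rightarrow> nat \<times> nat \<times> nat \<Rightarrow> complex" where
  "poly_mat_coords A = (\<lambda>(i, j, l).
     if i < dim_row A \<and> j < dim_col A then poly.coeff (A $$ (i, j)) l else 0)"

definition mat_coords :: "complex mat \<Rightarrow> nat \<times> nat \<Rightarrow> complex" where
  "mat_coords M = (\<lambda>(r, c). if r < dim_row M \<and> c < dim_col M then M $$ (r, c) else 0)"

end

theory Submission
  imports Defs "Jordan_Normal_Form.DL_Rank"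
begin

text \<open>
  Both varieties are affine spaces with the same coordinates, the numbers \<open>b\<^sub>i\<^sub>,\<^sub>j\<close> in degree \<open>l\<close> with
  \<open>l\<close> less than \<open>\<mu>\<close> at \<open>max i j\<close>, and the map \<open>A \<mapsto> \<^bold>M\<^bold>V\<^bold>y(A)\<close> is the identity in these
  coordinates. On \<open>S\<^sub>\<mu>\<close> this is a matter of reading off matrix entries (\<open>comp_mat\<close>,
  \<open>S_param\<close>).

  On \<open>W\<^sub>\<mu>\<close> the recursion for \<open>b\<close> has a closed form. Let \<open>L\<close> be \<open>x\<^sup>\<mu>\<close> minus the lower triangular part
  of the polynomial matrix \<open>b\<close>, diagonal included, and let \<open>u\<close> be the strictly upper triangular matrix with
  entries \<open>b\<^sub>i\<^sub>k / x^\<mu>\<^sub>k\<close>. The recursion says that \<open>A\<close> and the polynomial part of \<open>(1 - u) L\<close>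
  (\<open>slice_mat\<close>) have the same \<open>(i, j)\<close> coefficients in degrees below \<open>\<mu>\<close> at \<open>max i j\<close>. Two facts turn
  this into a parametrization. First, \<open>(1 - u) L\<close> lies in \<open>U\<^sub>1 x\<^sup>\<mu> T\<^sub>1 V\<^sub>1\<close>, and this set is stable under
  adding matrices over \<open>x\<inverse>\<complex>[[x\<inverse>]]\<close> (\<open>gauss_factors_perturb\<close>), so the polynomial part lies in \<open>W\<^sub>\<mu>\<close>.
  Second, an element of \<open>W\<^sub>\<mu>\<close> is determined by the coefficients in those degrees (\<open>W_slice_eqI\<close>), by
  Gauss elimination starting with the last pivot. Since \<open>b\<close> is polynomial in \<open>A\<close> and \<open>A\<close> in \<open>b\<close>, a chart
  of this kind also shows that the set is closed (\<open>polynomial_chart_affine_variety\<close>).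

  For the quotient, write \<open>A\<close> and \<open>M\<close> for the matrices with parameters \<open>b\<close> in \<open>W\<^sub>\<mu>\<close> and \<open>S\<^sub>\<mu>\<close>. The
  expression of \<open>A\<close> by \<open>b\<close> is equivalent to the relations stating that \<open>x\<close> acts on the vectors
  \<open>v\<^sub>i\<^sub>,\<^sub>k\<close> by the columns of \<open>M\<close>, exactly within a block, and up to column \<open>i\<close> of \<open>A\<close> at the end of
  block \<open>i\<close> (\<open>x_times_v\<close>). Hence the \<open>v\<^sub>i\<^sub>,\<^sub>k\<close> span the quotient. They are independent because the
  \<open>\<complex>[x]\<close>-linear map \<open>\<phi>\<close> to \<open>\<complex>\<^sup>N\<close>, with \<open>x\<close> acting by \<open>M\<close>, kills the columns of \<open>A\<close> and sends the
  \<open>v\<^sub>i\<^sub>,\<^sub>k\<close> to the unit vectors. So \<open>\<phi>\<close> identifies multiplication by \<open>x\<close> on the quotient with \<open>M\<close>,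
  which gives the matrix in the basis and the Jordan form at once, with no count of dimensions.
\<close>

section \<open>Laurent series of bounded degree\<close>

text \<open>Orders are taken in \<open>x\<inverse>\<close>: order at least \<open>1 - m\<close> means degree in \<open>x\<close> less than \<open>m\<close>.\<close>

definition order_ge :: "int \<Rightarrow> complex fls \<Rightarrow> bool" where
  "order_ge m f \<longleftrightarrow> (\<forall>k<m. fls_nth f k = 0)"

lemma order_ge_iff_subdegree: "order_ge m f \<longleftrightarrow> f = 0 \<or> m \<le> fls_subdegree f"
proof
  assume h: "order_ge m f"
  show "f = 0 \<or> m \<le> fls_subdegree f"
  proof (rule ccontr)
    assume c: "\<not> (f = 0 \<or> m \<le> fls_subdegree f)"
    then have "fls_nth f (fls_subdegree f) \<noteq> 0" by simp
    with h c show False by (auto simp: order_ge_def)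
  qed
qed (auto simp: order_ge_def)

lemma order_ge_0 [simp]: "order_ge m 0"
  by (simp add: order_ge_def)

lemma order_ge_mono: "order_ge m f \<Longrightarrow> m' \<le> m \<Longrightarrow> order_ge m' f"
  by (auto simp: order_ge_def)

lemma order_ge_add: "order_ge m f \<Longrightarrow> order_ge m g \<Longrightarrow> order_ge m (f + g)"
  by (auto simp: order_ge_def)

lemma order_ge_minus: "order_ge m (- f) \<longleftrightarrow> order_ge m f"
  by (auto simp: order_ge_def)

lemma order_ge_diff: "order_ge m f \<Longrightarrow> order_ge m g \<Longrightarrow> order_ge m (f - g)"
  by (auto simp: order_ge_def)

lemma order_ge_sum: "(\<And>i. i \<in> I \<Longrightarrow> order_ge m (f i)) \<Longrightarrow> order_ge m (sum f I)"
  by (induction I rule: infinite_finite_induct) (auto intro: order_ge_add)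

lemma order_ge_mult: "order_ge m f \<Longrightarrow> order_ge k g \<Longrightarrow> order_ge (m + k) (f * g)"
  by (cases "f = 0 \<or> g = 0") (auto simp: order_ge_iff_subdegree)

lemma xinv_series_iff: "f \<in> xinv_series \<longleftrightarrow> order_ge 1 f"
proof
  assume "f \<in> xinv_series"
  then obtain g where "f = fls_X * fps_to_fls g"
    by (auto simp: xinv_series_def)
  then show "order_ge 1 f"
    by (simp add: order_ge_def fls_X_times_conv_shift)
next
  assume h: "order_ge 1 f"
  have "f = fls_X * fps_to_fls (fls_regpart (fls_shift 1 f))"
  proof (rule fls_eqI)
    fix k
    show "fls_nth f k = fls_nth (fls_X * fps_to_fls (fls_regpart (fls_shift 1 f))) k"
      using h by (auto simp: fls_X_times_conv_shift order_ge_def)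
  qed
  then show "f \<in> xinv_series"
    unfolding xinv_series_def by blast
qed

abbreviation xpow :: "nat \<Rightarrow> complex fls" where
  "xpow m \<equiv> fls_X_inv ^ m"

lemma xpow_nonzero [simp]: "xpow m \<noteq> 0"
  by simp

lemma order_ge_xpow: "order_ge (- int m) (xpow m)"
  by (simp add: order_ge_def fls_X_inv_power_nth)

text \<open>The diagonal entries of \<open>x\<^sup>\<mu> T\<close> with \<open>T \<in> T\<^sub>1\<close> are exactly the series with leading term
  \<open>x\<^sup>m\<close>, where \<open>m\<close> is the entry of \<open>\<mu>\<close>.\<close>

definition pivot :: "nat \<Rightarrow> complex fls \<Rightarrow> bool" where
  "pivot m d \<longleftrightarrow> order_ge (1 - int m) (d - xpow m)"

lemma pivot_lead: "pivot m d \<Longrightarrow> fls_nth d (- int m) = 1"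
  unfolding pivot_def order_ge_def
  by (drule spec[of _ "- int m"]) (simp add: fls_X_inv_power_nth)

lemma pivot_nonzero: "pivot m d \<Longrightarrow> d \<noteq> 0"
  using pivot_lead by fastforce

lemma pivot_order: "pivot m d \<Longrightarrow> order_ge (- int m) d"
proof -
  assume h: "pivot m d"
  have "order_ge (- int m) ((d - xpow m) + xpow m)"
    using h by (intro order_ge_add order_ge_xpow) (auto simp: pivot_def elim: order_ge_mono)
  then show ?thesis by simp
qed

lemma pivot_inverse_order: "pivot m d \<Longrightarrow> order_ge (int m) (inverse d)"
proof -
  assume h: "pivot m d"
  have "fls_subdegree d = - int m"
    using pivot_order[OF h] pivot_lead[OF h]
    by (intro fls_subdegree_eqI) (auto simp: order_ge_def)
  then show ?thesis
    by (auto simp: order_ge_iff_subdegree fls_inverse_subdegree)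
qed

lemma pivot_perturb: "pivot m d \<Longrightarrow> order_ge 1 e \<Longrightarrow> pivot m (d + e)"
proof -
  assume h: "pivot m d" "order_ge 1 e"
  have "order_ge (1 - int m) ((d - xpow m) + e)"
    using h by (intro order_ge_add) (auto simp: pivot_def elim: order_ge_mono)
  then show ?thesis by (simp add: pivot_def algebra_simps)
qed

lemma pivot_iff_scaled: "pivot m (xpow m * t) \<longleftrightarrow> order_ge 1 (t - 1)"
proof
  assume "pivot m (xpow m * t)"
  then have "order_ge (1 - int m) (xpow m * (t - 1))"
    by (simp add: pivot_def algebra_simps)
  then show "order_ge 1 (t - 1)"
    by (cases "t = 1") (auto simp: order_ge_iff_subdegree fls_subdegree_pow)
next
  assume "order_ge 1 (t - 1)"
  then have "order_ge (- int m + 1) (xpow m * (t - 1))"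
    by (intro order_ge_mult order_ge_xpow)
  then show "pivot m (xpow m * t)"
    by (simp add: pivot_def algebra_simps)
qed

section \<open>Polynomials as Laurent series\<close>

lemma laurent_of_poly_0 [simp]: "laurent_of_poly 0 = 0"
  by (simp add: laurent_of_poly_def)

lemma laurent_of_poly_pCons:
  "laurent_of_poly (pCons a p) = fls_const a + fls_X_inv * laurent_of_poly p"
  by (simp add: laurent_of_poly_def Polynomial.map_poly_pCons[of fls_const, OF fls_const_0])

lemma laurent_of_poly_nth:
  "fls_nth (laurent_of_poly p) k = (if k \<le> 0 then poly.coeff p (nat (- k)) else 0)"
proof (induction p arbitrary: k)
  case (pCons a p)
  have "nat (- k) = Suc (nat (- (k + 1)))" if "k < 0" using that by simp
  then show ?case
    using pCons.IH[of "k + 1"]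
    by (cases "k = 0"; cases "k < 0")
       (auto simp: laurent_of_poly_pCons fls_X_inv_times_conv_shift fls_const_nth coeff_pCons)
qed auto

lemma laurent_of_poly_add: "laurent_of_poly (p + q) = laurent_of_poly p + laurent_of_poly q"
  by (rule fls_eqI) (simp add: laurent_of_poly_nth)

lemma laurent_of_poly_diff: "laurent_of_poly (p - q) = laurent_of_poly p - laurent_of_poly q"
  by (rule fls_eqI) (simp add: laurent_of_poly_nth)

lemma laurent_of_poly_sum: "laurent_of_poly (sum f I) = (\<Sum>i\<in>I. laurent_of_poly (f i))"
  by (induction I rule: infinite_finite_induct) (auto simp: laurent_of_poly_add)

lemma laurent_of_poly_smult: "laurent_of_poly (Polynomial.smult c p) = fls_const c * laurent_of_poly p"
  by (rule fls_eqI) (simp add: laurent_of_poly_nth fls_mult_const_nth)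

lemma laurent_of_poly_mult: "laurent_of_poly (p * q) = laurent_of_poly p * laurent_of_poly q"
proof (induction p)
  case (pCons a p)
  have "laurent_of_poly (pCons a p * q) = laurent_of_poly (Polynomial.smult a q) + laurent_of_poly (pCons 0 (p * q))"
    by (simp add: laurent_of_poly_add)
  also have "\<dots> = fls_const a * laurent_of_poly q + fls_X_inv * (laurent_of_poly p * laurent_of_poly q)"
    by (simp only: laurent_of_poly_smult laurent_of_poly_pCons pCons.IH) simp
  finally show ?case
    by (simp add: laurent_of_poly_pCons algebra_simps)
qed simp

lemma laurent_of_poly_monom_1: "laurent_of_poly (monom 1 m) = xpow m"
  by (rule fls_eqI) (auto simp: laurent_of_poly_nth fls_X_inv_power_nth)

lemma laurent_of_poly_inject: "laurent_of_poly p = laurent_of_poly q \<longleftrightarrow> p = q"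
proof
  assume h: "laurent_of_poly p = laurent_of_poly q"
  show "p = q"
  proof (rule poly_eqI)
    fix l
    show "poly.coeff p l = poly.coeff q l"
      using arg_cong[OF h, of "\<lambda>f. fls_nth f (- int l)"] by (simp add: laurent_of_poly_nth)
  qed
qed simp

lemma order_ge_laurent_of_poly:
  "order_ge (1 - int m) (laurent_of_poly p) \<longleftrightarrow> (\<forall>l\<ge>m. poly.coeff p l = 0)"
proof
  assume h: "order_ge (1 - int m) (laurent_of_poly p)"
  show "\<forall>l\<ge>m. poly.coeff p l = 0"
  proof (intro allI impI)
    fix l assume "m \<le> l"
    then show "poly.coeff p l = 0"
      using h[unfolded order_ge_def, rule_format, of "- int l"] by (simp add: laurent_of_poly_nth)
  qed
qed (auto simp: order_ge_def laurent_of_poly_nth)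

text \<open>Dropping the \<open>m\<close> lowest coefficients is division by \<open>x\<^sup>m\<close> followed by truncation to the
  polynomial part.\<close>

lemma laurent_of_poly_shift_approx:
  "order_ge 1 (laurent_of_poly (poly_shift m p) - laurent_of_poly p * inverse (xpow m))"
proof -
  have "inverse (xpow m) = fls_X ^ m"
    by (metis fls_inverse_X_inv fls_inverse_X power_inverse)
  then show ?thesis
    by (auto simp: order_ge_def laurent_of_poly_nth coeff_poly_shift
        fls_X_power_times_conv_shift nat_diff_distrib intro!: arg_cong[of _ _ "poly.coeff p"])
qed

section \<open>Gauss decomposition over the Laurent series\<close>

text \<open>Matrices are functions here, with the size as a separate argument, so that it can vary in an
  induction; \<open>x\<^sup>\<mu> T\<close> is merged into one sequence of pivots.\<close>

definition unipotent_upper :: "nat \<Rightarrow> (nat \<Rightarrow> nat \<Rightarrow> complex fls) \<Rightarrow> bool" where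
  "unipotent_upper n U \<longleftrightarrow>
     (\<forall>i<n. U i i = 1 \<and> (\<forall>j<i. U i j = 0) \<and> (\<forall>j<n. i < j \<longrightarrow> order_ge 1 (U i j)))"

definition gauss_factors ::
  "nat \<Rightarrow> (nat \<Rightarrow> nat) \<Rightarrow> (nat \<Rightarrow> nat \<Rightarrow> complex fls) \<Rightarrow> (nat \<Rightarrow> complex fls) \<Rightarrow>
   (nat \<Rightarrow> nat \<Rightarrow> complex fls) \<Rightarrow> bool" where
  "gauss_factors n m U D V \<longleftrightarrow> unipotent_upper n U \<and> (\<forall>k<n. pivot (m k) (D k)) \<and>
     unipotent_upper n (\<lambda>i j. V j i)"

lemma W_slice_iff:
  "A \<in> W_slice mu \<longleftrightarrow> A \<in> carrier_mat (length mu) (length mu) \<and>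
     (\<exists>U D V. gauss_factors (length mu) (nth mu) U D V \<and>
        (\<forall>i<length mu. \<forall>j<length mu.
           laurent_of_poly (A $$ (i, j)) = (\<Sum>k<length mu. U i k * D k * V k j)))"
  (is "_ \<longleftrightarrow> ?C \<and> ?G")
proof
  let ?n = "length mu"
  assume h: "A \<in> W_slice mu"
  then have A: ?C by (simp add: W_slice_def)
  from h obtain U T V where U: "U \<in> U1 ?n" and T: "T \<in> T1 ?n" and V: "V \<in> V1 ?n"
    and eq: "map_mat laurent_of_poly A = U * x_pow_mu mu * T * V"
    by (auto simp: W_slice_def)
  from T obtain t where t: "T = mat_diag ?n t" "\<forall>i<?n. t i - 1 \<in> xinv_series"
    by (auto simp: T1_def)
  from V obtain V' where V': "V' \<in> U1 ?n" "V = transpose_mat V'"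
    by (auto simp: V1_def)
  have Uc: "U \<in> carrier_mat ?n ?n" and Vc: "V \<in> carrier_mat ?n ?n"
    using U V' by (auto simp: U1_def)
  have "gauss_factors ?n (nth mu) (\<lambda>i k. U $$ (i, k)) (\<lambda>k. xpow (mu ! k) * t k) (\<lambda>k j. V $$ (k, j))"
    using U V' t
    by (auto simp: gauss_factors_def unipotent_upper_def U1_def pivot_iff_scaled xinv_series_iff)
  moreover have "laurent_of_poly (A $$ (i, j)) =
      (\<Sum>k<?n. U $$ (i, k) * (xpow (mu ! k) * t k) * V $$ (k, j))" if ij: "i < ?n" "j < ?n" for i j
  proof -
    have "laurent_of_poly (A $$ (i, j)) = map_mat laurent_of_poly A $$ (i, j)"
      using A ij by simp
    also have "\<dots> = (\<Sum>k<?n. U $$ (i, k) * (xpow (mu ! k) * t k) * V $$ (k, j))"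
      unfolding eq t x_pow_mu_def using Uc Vc ij
      by (simp add: mat_diag_mult_right[OF Uc] mat_diag_mult_right[of _ ?n ?n]
          scalar_prod_def atLeast0LessThan algebra_simps)
    finally show ?thesis .
  qed
  ultimately show "?C \<and> ?G" using A by blast
next
  let ?n = "length mu"
  assume h: "?C \<and> ?G"
  then obtain U D V where A: ?C and g: "gauss_factors ?n (nth mu) U D V"
    and eq: "\<And>i j. i < ?n \<Longrightarrow> j < ?n \<Longrightarrow>
        laurent_of_poly (A $$ (i, j)) = (\<Sum>k<?n. U i k * D k * V k j)"
    by auto
  define t where "t k = inverse (xpow (mu ! k)) * D k" for k
  have D: "D k = xpow (mu ! k) * t k" for k
    unfolding t_def by (metis mult.assoc mult_1 right_inverse xpow_nonzero)
  define U' where "U' = mat ?n ?n (\<lambda>(i, k). U i k)"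
  define V' where "V' = mat ?n ?n (\<lambda>(k, j). V k j)"
  have Uc: "U' \<in> carrier_mat ?n ?n" and Vc: "V' \<in> carrier_mat ?n ?n"
    by (auto simp: U'_def V'_def)
  have "U' \<in> U1 ?n"
    using g by (auto simp: gauss_factors_def unipotent_upper_def U1_def U'_def xinv_series_iff)
  moreover have "transpose_mat V' \<in> U1 ?n"
    using g by (auto simp: gauss_factors_def unipotent_upper_def U1_def V'_def xinv_series_iff)
  then have "V' \<in> V1 ?n"
    unfolding V1_def by (metis imageI transpose_transpose)
  moreover have "mat_diag ?n t \<in> T1 ?n"
    using g unfolding T1_def
    by (auto simp: gauss_factors_def D pivot_iff_scaled xinv_series_iff)
  moreover have "map_mat laurent_of_poly A = U' * x_pow_mu mu * mat_diag ?n t * V'"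
  proof (rule eq_matI)
    fix i j
    assume "i < dim_row (U' * x_pow_mu mu * mat_diag ?n t * V')"
      and "j < dim_col (U' * x_pow_mu mu * mat_diag ?n t * V')"
    then have ij: "i < ?n" "j < ?n" using Uc Vc by auto
    then show "map_mat laurent_of_poly A $$ (i, j) = (U' * x_pow_mu mu * mat_diag ?n t * V') $$ (i, j)"
      unfolding x_pow_mu_def using A Uc Vc
      by (simp add: eq mat_diag_mult_right[OF Uc] mat_diag_mult_right[of _ ?n ?n]
          scalar_prod_def atLeast0LessThan algebra_simps U'_def V'_def D)
  qed (use A Uc Vc in auto)
  ultimately show "A \<in> W_slice mu"
    using A by (auto simp: W_slice_def)
qed

text \<open>The set \<open>U\<^sub>1 x\<^sup>\<mu> T\<^sub>1 V\<^sub>1\<close> is stable under adding matrices with entries in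
  \<open>x\<inverse>\<complex>[[x\<inverse>]]\<close>. Eliminating with the last pivot reduces the size by one. Since \<open>\<mu>\<close> has no
  negative entries, the inverse of a pivot has nonnegative order, and so the Schur complement is again
  a perturbation by \<open>x\<inverse>\<complex>[[x\<inverse>]]\<close> of the remaining product.\<close>

lemma gauss_factors_perturb:
  assumes "gauss_factors n m U D V"
    and "\<And>i j. i < n \<Longrightarrow> j < n \<Longrightarrow> order_ge 1 (a i j - (\<Sum>k<n. U i k * D k * V k j))"
  shows "\<exists>U' D' V'. gauss_factors n m U' D' V' \<and>
    (\<forall>i<n. \<forall>j<n. a i j = (\<Sum>k<n. U' i k * D' k * V' k j))"
  using assms
proof (induction n arbitrary: a)
  case 0
  then show ?case by (auto simp: gauss_factors_def unipotent_upper_def)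
next
  case (Suc n)
  define e where "e i j = a i j - (\<Sum>k<Suc n. U i k * D k * V k j)" for i j
  have e: "order_ge 1 (e i j)" if "i \<le> n" "j \<le> n" for i j
    using Suc.prems(2) that by (simp add: e_def)
  have a: "a i j = (\<Sum>k<n. U i k * D k * V k j) + U i n * D n * V n j + e i j" for i j
    by (simp add: e_def)
  have g: "gauss_factors n m U D V"
    using Suc.prems(1) by (auto simp: gauss_factors_def unipotent_upper_def)
  have Unn: "U n n = 1" "V n n = 1" and U0: "\<And>k. k < n \<Longrightarrow> U n k = 0" "\<And>k. k < n \<Longrightarrow> V k n = 0"
    and Uo: "\<And>i. i < n \<Longrightarrow> order_ge 1 (U i n)" "\<And>i. i < n \<Longrightarrow> order_ge 1 (V n i)"
    and Dn: "pivot (m n) (D n)"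
    using Suc.prems(1) by (auto simp: gauss_factors_def unipotent_upper_def)
  have ann: "a n n = D n + e n n" and ain: "\<And>i. a i n = U i n * D n + e i n"
    and anj: "\<And>j. a n j = D n * V n j + e n j"
    by (simp_all add: a Unn U0)
  have p: "pivot (m n) (a n n)"
    unfolding ann by (intro pivot_perturb Dn e) auto
  have nz: "a n n \<noteq> 0" by (rule pivot_nonzero[OF p])
  have inv: "order_ge 0 (inverse (a n n))"
    by (rule order_ge_mono[OF pivot_inverse_order[OF p]]) simp
  have Dinv: "order_ge 0 (D n * inverse (a n n))"
    using order_ge_mult[OF pivot_order[OF Dn] pivot_inverse_order[OF p]] by simp
  have schur: "x - p * inverse c = q * inverse c" if "x * c - p = q" "c \<noteq> 0" for x p q c :: "complex fls"
    using that(2) unfolding that(1)[symmetric] by (simp add: left_diff_distrib mult.assoc)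
  define s where "s i j = a i j - a i n * a n j * inverse (a n n)" for i j
  have "order_ge 1 (s i j - (\<Sum>k<n. U i k * D k * V k j))" if ij: "i < n" "j < n" for i j
  proof -
    have "(U i n * D n * V n j) - a i n * a n j * inverse (a n n) =
       (U i n * V n j * e n n - U i n * e n j - e i n * V n j) * (D n * inverse (a n n))
        - e i n * e n j * inverse (a n n)"
    proof -
      have "(U i n * D n * V n j) * a n n - a i n * a n j =
         (U i n * V n j * e n n - U i n * e n j - e i n * V n j) * D n - e i n * e n j"
        unfolding ann ain[of i] anj[of j] by (simp add: algebra_simps)
      from schur[OF this nz] show ?thesis
        by (simp only: left_diff_distrib mult.assoc)
    qed
    then have eq: "s i j - (\<Sum>k<n. U i k * D k * V k j) = e i j +
       ((U i n * V n j * e n n - U i n * e n j - e i n * V n j) * (D n * inverse (a n n))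
        - e i n * e n j * inverse (a n n))"
      unfolding s_def a[of i j] by (simp add: algebra_simps)
    have o: "order_ge 1 (e i j)" "order_ge 1 (e n n)" "order_ge 1 (e n j)" "order_ge 1 (e i n)"
      using ij by (auto intro: e)
    have "order_ge 1 (U i n * V n j * e n n)"
      by (rule order_ge_mono[OF order_ge_mult[OF order_ge_mult[OF Uo(1)[OF ij(1)] Uo(2)[OF ij(2)]] o(2)]]) simp
    moreover have "order_ge 1 (U i n * e n j)"
      by (rule order_ge_mono[OF order_ge_mult[OF Uo(1)[OF ij(1)] o(3)]]) simp
    moreover have "order_ge 1 (e i n * V n j)"
      by (rule order_ge_mono[OF order_ge_mult[OF o(4) Uo(2)[OF ij(2)]]]) simp
    ultimately have "order_ge 1 (U i n * V n j * e n n - U i n * e n j - e i n * V n j)"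
      by (intro order_ge_diff)
    from order_ge_mult[OF this Dinv]
    have 1: "order_ge 1 ((U i n * V n j * e n n - U i n * e n j - e i n * V n j) * (D n * inverse (a n n)))"
      by simp
    have 2: "order_ge 1 (e i n * e n j * inverse (a n n))"
      by (rule order_ge_mono[OF order_ge_mult[OF order_ge_mult[OF o(4) o(3)] inv]]) simp
    show ?thesis
      unfolding eq by (intro order_ge_add order_ge_diff o 1 2)
  qed
  from Suc.IH[OF g this] obtain U' D' V' where g': "gauss_factors n m U' D' V'"
    and s: "\<And>i j. i < n \<Longrightarrow> j < n \<Longrightarrow> s i j = (\<Sum>k<n. U' i k * D' k * V' k j)"
    by blast
  define U2 where "U2 i k = (if k = n then a i n * inverse (a n n) else if i = n then 0 else U' i k)" for i k
  define D2 where "D2 k = (if k = n then a n n else D' k)" for k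
  define V2 where "V2 k j = (if k = n then inverse (a n n) * a n j else if j = n then 0 else V' k j)" for k j
  have oin: "order_ge 1 (a i n * inverse (a n n))" if "i < n" for i
  proof -
    have "order_ge 1 (U i n * (D n * inverse (a n n)) + e i n * inverse (a n n))"
      using order_ge_mult[OF Uo(1)[OF that] Dinv] order_ge_mult[OF e[of i n] inv] that
      by (intro order_ge_add) auto
    then show ?thesis by (simp add: ain algebra_simps)
  qed
  have onj: "order_ge 1 (inverse (a n n) * a n j)" if "j < n" for j
  proof -
    have "order_ge 1 (V n j * (D n * inverse (a n n)) + e n j * inverse (a n n))"
      using order_ge_mult[OF Uo(2)[OF that] Dinv] order_ge_mult[OF e[of n j] inv] that
      by (intro order_ge_add) auto
    then show ?thesis by (simp add: anj algebra_simps)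
  qed
  have "gauss_factors (Suc n) m U2 D2 V2"
    using g' p nz oin onj unfolding gauss_factors_def unipotent_upper_def
    by (auto simp: U2_def D2_def V2_def less_Suc_eq)
  moreover have "a i j = (\<Sum>k<Suc n. U2 i k * D2 k * V2 k j)" if "i < Suc n" "j < Suc n" for i j
  proof (cases "i = n \<or> j = n")
    case True
    then have "(\<Sum>k<n. U2 i k * D2 k * V2 k j) = 0"
      by (auto simp: U2_def V2_def)
    then show ?thesis using True nz by (auto simp: U2_def D2_def V2_def)
  next
    case False
    then have ij: "i < n" "j < n" using that by auto
    have "(\<Sum>k<n. U2 i k * D2 k * V2 k j) = s i j"
      using False by (simp add: s[OF ij] U2_def D2_def V2_def)
    then show ?thesis using nz by (simp add: s_def U2_def D2_def V2_def)
  qed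
  ultimately show ?case by blast
qed

section \<open>An element of the slice is determined by its low coefficients\<close>

text \<open>Descending induction on the pivot: once the pivots, the columns of \<open>U\<close> and the rows of \<open>V\<close> with index \<open>k > m\<close> agree, the
  entries with larger index \<open>m\<close> differ only by series of degree less than \<open>\<mu>\<^sub>m\<close>; a polynomial
  difference of that degree with vanishing low coefficients is zero.\<close>

lemma W_slice_eqI:
  assumes A: "A \<in> W_slice mu" and A': "A' \<in> W_slice mu"
    and low: "\<And>i j l. i < length mu \<Longrightarrow> j < length mu \<Longrightarrow> l < mu ! max i j \<Longrightarrow>
      poly.coeff (A $$ (i, j)) l = poly.coeff (A' $$ (i, j)) l"
  shows "A = A'"
proof -
  let ?n = "length mu"
  from A obtain U D V where g: "gauss_factors ?n (nth mu) U D V"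
    and a: "\<And>i j. i < ?n \<Longrightarrow> j < ?n \<Longrightarrow>
        laurent_of_poly (A $$ (i, j)) = (\<Sum>k<?n. U i k * D k * V k j)"
    by (auto simp: W_slice_iff)
  from A' obtain U' D' V' where g': "gauss_factors ?n (nth mu) U' D' V'"
    and a': "\<And>i j. i < ?n \<Longrightarrow> j < ?n \<Longrightarrow>
        laurent_of_poly (A' $$ (i, j)) = (\<Sum>k<?n. U' i k * D' k * V' k j)"
    by (auto simp: W_slice_iff)
  have tri: "U k k = 1" "V k k = 1" "\<And>i. i < k \<Longrightarrow> order_ge 1 (U i k)"
      "\<And>i. i < k \<Longrightarrow> order_ge 1 (V k i)" "pivot (mu ! k) (D k)"
      "\<And>i. i < k \<Longrightarrow> U k i = 0" "\<And>i. i < k \<Longrightarrow> V i k = 0"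
    and tri': "U' k k = 1" "V' k k = 1" "\<And>i. i < k \<Longrightarrow> order_ge 1 (U' i k)"
      "\<And>i. i < k \<Longrightarrow> order_ge 1 (V' k i)" "pivot (mu ! k) (D' k)"
      "\<And>i. i < k \<Longrightarrow> U' k i = 0" "\<And>i. i < k \<Longrightarrow> V' i k = 0"
    if "k < ?n" for k
    using g g' that by (auto simp: gauss_factors_def unipotent_upper_def)
  have split_sum: "(\<Sum>k<?n. f k) = f m + (\<Sum>k\<in>{m<..<?n}. f k)"
    if "m < ?n" "\<And>k. k < m \<Longrightarrow> f k = 0" for f :: "nat \<Rightarrow> complex fls" and m
  proof -
    have "(\<Sum>k<?n. f k) = (\<Sum>k\<in>{m..<?n}. f k)"
      using that by (intro sum.mono_neutral_right) auto
    also have "{m..<?n} = insert m {m<..<?n}" using that(1) by auto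
    finally show ?thesis by simp
  qed
  define agree where "agree k \<longleftrightarrow> D k = D' k \<and> (\<forall>i<?n. U i k = U' i k \<and> V k i = V' k i)" for k
  have vanish: "A $$ (i, j) = A' $$ (i, j)"
    if ij: "i < ?n" "j < ?n" "max i j = m"
      and o: "order_ge (1 - int (mu ! m)) (laurent_of_poly (A $$ (i, j)) - laurent_of_poly (A' $$ (i, j)))"
    for i j m
  proof (rule poly_eqI)
    fix l
    have "\<forall>l\<ge>mu ! m. poly.coeff (A $$ (i, j) - A' $$ (i, j)) l = 0"
      using o unfolding laurent_of_poly_diff[symmetric] order_ge_laurent_of_poly .
    then show "poly.coeff (A $$ (i, j)) l = poly.coeff (A' $$ (i, j)) l"
      using low[of i j l] ij by (cases "l < mu ! m") auto
  qed
  have "agree m" if "m < ?n" for m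
    using that
  proof (induction "?n - m" arbitrary: m rule: less_induct)
    case less
    note m = \<open>m < ?n\<close>
    have IH: "agree k" if "m < k" "k < ?n" for k
      using less.hyps[of k] that by auto
    have rest: "(\<Sum>k\<in>{m<..<?n}. U i k * D k * V k j) = (\<Sum>k\<in>{m<..<?n}. U' i k * D' k * V' k j)"
      if "i < ?n" "j < ?n" for i j
      using IH that by (intro sum.cong) (auto simp: agree_def)
    have d: "laurent_of_poly (A $$ (i, j)) - laurent_of_poly (A' $$ (i, j)) =
        U i m * D m * V m j - U' i m * D' m * V' m j" if "i < ?n" "j < ?n" "max i j = m" for i j
    proof -
      have "U i k * D k * V k j = 0 \<and> U' i k * D' k * V' k j = 0" if "k < m" for k
        using that tri(6,7)[OF m, of k] tri'(6,7)[OF m, of k] \<open>max i j = m\<close>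
        by (auto simp: max_def split: if_splits)
      then show ?thesis
        using that by (simp add: a a' split_sum[OF m] rest)
    qed
    have Dm: "D m = D' m"
    proof -
      have "order_ge (1 - int (mu ! m)) ((D m - xpow (mu ! m)) - (D' m - xpow (mu ! m)))"
        by (rule order_ge_diff[OF tri(5)[OF m, unfolded pivot_def] tri'(5)[OF m, unfolded pivot_def]])
      then have "A $$ (m, m) = A' $$ (m, m)"
        using m d[of m m] by (intro vanish[of m m m]) (auto simp: tri tri')
      then show ?thesis using d[of m m] m by (simp add: tri tri')
    qed
    have nz: "D' m \<noteq> 0" by (rule pivot_nonzero[OF tri'(5)[OF m]])
    have small: "order_ge (1 - int (mu ! m)) (f * D' m)" if "order_ge 1 f" for f
      using order_ge_mult[OF that pivot_order[OF tri'(5)[OF m]]] by simp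
    have "U i m = U' i m \<and> V m i = V' m i" if i: "i < ?n" for i
    proof -
      consider "i < m" | "i = m" | "m < i" by linarith
      then show ?thesis
      proof cases
        case 1
        have e1: "laurent_of_poly (A $$ (i, m)) - laurent_of_poly (A' $$ (i, m)) = U i m * D' m - U' i m * D' m"
          using d[of i m] i m 1 by (simp add: tri tri' Dm)
        have "A $$ (i, m) = A' $$ (i, m)"
          using i m 1 tri(3)[OF m 1] tri'(3)[OF m 1] unfolding e1
          by (intro vanish[of i m m]) (auto simp: e1 intro!: order_ge_diff small)
        then have U: "U i m = U' i m" using e1 nz by simp
        have e2: "laurent_of_poly (A $$ (m, i)) - laurent_of_poly (A' $$ (m, i)) = V m i * D' m - V' m i * D' m"
          using d[of m i] i m 1 by (simp add: tri tri' Dm mult.commute)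
        have "A $$ (m, i) = A' $$ (m, i)"
          using i m 1 tri(4)[OF m 1] tri'(4)[OF m 1]
          by (intro vanish[of m i m]) (auto simp: e2 intro!: order_ge_diff small)
        then have "V m i = V' m i" using e2 nz by simp
        with U show ?thesis by simp
      qed (use m i tri(1,2)[OF m] tri'(1,2)[OF m] tri(6,7)[OF i, of m] tri'(6,7)[OF i, of m] in auto)
    qed
    with Dm show "agree m" by (simp add: agree_def)
  qed
  then have "laurent_of_poly (A $$ (i, j)) = laurent_of_poly (A' $$ (i, j))" if "i < ?n" "j < ?n" for i j
    using that by (auto simp: a a' agree_def intro!: sum.cong)
  moreover have "A \<in> carrier_mat ?n ?n" "A' \<in> carrier_mat ?n ?n"
    using A A' by (auto simp: W_slice_iff)
  ultimately show ?thesis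
    by (intro eq_matI) (auto simp: laurent_of_poly_inject)
qed

section \<open>Parametrization of the slice by the coefficients \<open>b\<close>\<close>

definition param_index :: "nat list \<Rightarrow> (nat \<times> nat \<times> nat) set" where
  "param_index mu = {(i, j, l). i < length mu \<and> j < length mu \<and> l < mu ! max i j}"

definition affine_space :: "'t set \<Rightarrow> ('t \<Rightarrow> complex) set" where
  "affine_space J = {b. \<forall>t. t \<notin> J \<longrightarrow> b t = 0}"

abbreviation param_space :: "nat list \<Rightarrow> (nat \<times> nat \<times> nat \<Rightarrow> complex) set" where
  "param_space mu \<equiv> affine_space (param_index mu)"

definition bpoly :: "nat list \<Rightarrow> (nat \<times> nat \<times> nat \<Rightarrow> complex) \<Rightarrow> nat \<Rightarrow> nat \<Rightarrow> complex poly" where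
  "bpoly mu b i j = (\<Sum>l<mu ! max i j. monom (b (i, j, l)) l)"

text \<open>This is the polynomial part of the \<open>(i, j)\<close> entry of \<open>(1 - u) L\<close>, where \<open>u\<close> is the strictly upper
  triangular matrix with entries \<open>u\<^sub>i\<^sub>k = b\<^sub>i\<^sub>k / x^\<mu>\<^sub>k\<close>, and \<open>L\<close> is \<open>x\<^sup>\<mu>\<close> minus the
  lower triangular part, diagonal included, of \<open>b\<close>.\<close>

definition slice_entry :: "nat list \<Rightarrow> (nat \<times> nat \<times> nat \<Rightarrow> complex) \<Rightarrow> nat \<Rightarrow> nat \<Rightarrow> complex poly" where
  "slice_entry mu b i j = (if i = j then monom 1 (mu ! i) else 0) - bpoly mu b i j +
     (\<Sum>k\<in>{max j (Suc i)..<length mu}. poly_shift (mu ! k) (bpoly mu b k j * bpoly mu b i k))"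

definition slice_mat :: "nat list \<Rightarrow> (nat \<times> nat \<times> nat \<Rightarrow> complex) \<Rightarrow> complex poly mat" where
  "slice_mat mu b = mat (length mu) (length mu) (\<lambda>(i, j). slice_entry mu b i j)"

lemma coeff_bpoly: "poly.coeff (bpoly mu b i j) l = (if l < mu ! max i j then b (i, j, l) else 0)"
  by (simp add: bpoly_def coeff_sum)

text \<open>The matrix \<open>(1 - u) L\<close> visibly lies in \<open>U\<^sub>1 x\<^sup>\<mu> T\<^sub>1 V\<^sub>1\<close>, because
  \<open>b\<^sub>i\<^sub>k\<close> for \<open>i < k\<close> and \<open>b\<^sub>k\<^sub>j\<close> for \<open>j \<le> k\<close> have degree below \<open>\<mu>\<^sub>k\<close>; passing to the polynomial part is a perturbation
  in \<open>x\<inverse>\<complex>[[x\<inverse>]]\<close>.\<close>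

lemma slice_mat_in_W_slice: "slice_mat mu b \<in> W_slice mu"
proof -
  let ?n = "length mu"
  let ?B = "\<lambda>i j. laurent_of_poly (bpoly mu b i j)"
  define U where "U i k = (if i = k then 1 else if i < k then - ?B i k * inverse (xpow (mu ! k)) else 0)" for i k
  define D where "D k = xpow (mu ! k) - ?B k k" for k
  define V where "V k j = (if k = j then 1 else if j < k then - inverse (D k) * ?B k j else 0)" for k j
  have B: "order_ge (1 - int (mu ! max i j)) (?B i j)" for i j
    by (simp add: order_ge_laurent_of_poly coeff_bpoly)
  have piv: "pivot (mu ! k) (D k)" for k
    using B[of k k] by (simp add: pivot_def D_def order_ge_minus)
  have "inverse (xpow m) = fls_X ^ m" for m
    by (metis fls_inverse_X_inv power_inverse)
  then have xi: "order_ge (int m) (inverse (xpow m))" for m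
    by (simp add: order_ge_def fls_X_power_nth)
  have "order_ge 1 (U i k)" if "i < k" for i k
    using order_ge_mult[OF B[of i k] xi[of "mu ! k"]] that
    by (simp add: U_def order_ge_minus max_def)
  moreover have "order_ge 1 (V k j)" if "j < k" for k j
    using order_ge_mult[OF B[of k j] pivot_inverse_order[OF piv[of k]]] that
    by (simp add: V_def order_ge_minus max_def mult.commute)
  ultimately have g: "gauss_factors ?n (nth mu) U D V"
    using piv by (auto simp: gauss_factors_def unipotent_upper_def U_def V_def)
  have "order_ge 1 (laurent_of_poly (slice_entry mu b i j) - (\<Sum>k<?n. U i k * D k * V k j))"
    if ij: "i < ?n" "j < ?n" for i j
  proof -
    have DV: "D k * V k j = (if k = j then xpow (mu ! j) else 0) - (if j \<le> k then ?B k j else 0)" for k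
      using pivot_nonzero[OF piv[of k]] by (auto simp: V_def D_def)
    have "(\<Sum>k<?n. U i k * D k * V k j) = (\<Sum>k<?n. U i k * (D k * V k j))"
      by (simp add: mult.assoc)
    also have "\<dots> = U i j * xpow (mu ! j) - (\<Sum>k<?n. if j \<le> k then U i k * ?B k j else 0)"
    proof -
      have "(\<Sum>k<?n. U i k * (D k * V k j)) =
          (\<Sum>k<?n. (if k = j then U i j * xpow (mu ! j) else 0) - (if j \<le> k then U i k * ?B k j else 0))"
        unfolding DV by (intro sum.cong) (auto simp: right_diff_distrib)
      then show ?thesis using ij by (simp add: sum_subtractf)
    qed
    also have "(\<Sum>k<?n. if j \<le> k then U i k * ?B k j else 0) = (\<Sum>k\<in>{j..<?n}. U i k * ?B k j)"
      by (simp add: sum.If_cases) (intro sum.cong, auto)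
    also have "\<dots> = (if j \<le> i then ?B i j else 0)
        - (\<Sum>k\<in>{max j (Suc i)..<?n}. inverse (xpow (mu ! k)) * ?B i k * ?B k j)"
    proof -
      have "(\<Sum>k\<in>{j..<?n}. U i k * ?B k j) =
          (\<Sum>k\<in>{j..<?n}. (if k = i then ?B i j else 0) -
             (if k \<in> {max j (Suc i)..<?n} then inverse (xpow (mu ! k)) * ?B i k * ?B k j else 0))"
        by (intro sum.cong) (auto simp: U_def mult.commute)
      also have "\<dots> = (if j \<le> i then ?B i j else 0)
        - (\<Sum>k\<in>{j..<?n} \<inter> {max j (Suc i)..<?n}. inverse (xpow (mu ! k)) * ?B i k * ?B k j)"
        using ij by (simp only: sum_subtractf sum.inter_restrict[symmetric] finite_atLeastLessThan) simp
      also have "{j..<?n} \<inter> {max j (Suc i)..<?n} = {max j (Suc i)..<?n}" by auto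
      finally show ?thesis .
    qed
    also have "U i j * xpow (mu ! j) = (if i = j then xpow (mu ! i) else 0) - (if i < j then ?B i j else 0)"
      by (auto simp: U_def mult.assoc left_inverse[OF xpow_nonzero] simp del: fls_inverse_X_inv)
    finally have "laurent_of_poly (slice_entry mu b i j) - (\<Sum>k<?n. U i k * D k * V k j) =
       (\<Sum>k\<in>{max j (Suc i)..<?n}.
          laurent_of_poly (poly_shift (mu ! k) (bpoly mu b k j * bpoly mu b i k))
          - laurent_of_poly (bpoly mu b k j * bpoly mu b i k) * inverse (xpow (mu ! k)))"
      unfolding slice_entry_def
      by (auto simp: laurent_of_poly_add laurent_of_poly_diff laurent_of_poly_sum sum_subtractf
          laurent_of_poly_monom_1 laurent_of_poly_mult mult_ac)
    also have "order_ge 1 \<dots>"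
      by (intro order_ge_sum laurent_of_poly_shift_approx)
    finally show ?thesis .
  qed
  from gauss_factors_perturb[OF g, of "\<lambda>i j. laurent_of_poly (slice_entry mu b i j)", OF this]
  show ?thesis
    by (auto simp: W_slice_iff slice_mat_def)
qed

lemma coeff_bpoly_mult_shift:
  assumes "i \<le> k" "j \<le> k"
  shows "poly.coeff (poly_shift (mu ! k) (bpoly mu b k j * bpoly mu b i k)) l =
    (\<Sum>p<mu ! k. poly.coeff (bpoly mu b k j) p * poly.coeff (bpoly mu b i k) (mu ! k + l - p))"
proof -
  have "poly.coeff (poly_shift (mu ! k) (bpoly mu b k j * bpoly mu b i k)) l =
    (\<Sum>p\<le>mu ! k + l. poly.coeff (bpoly mu b k j) p * poly.coeff (bpoly mu b i k) (mu ! k + l - p))"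
    by (simp add: coeff_poly_shift coeff_mult add.commute)
  also have "\<dots> = (\<Sum>p<mu ! k. poly.coeff (bpoly mu b k j) p * poly.coeff (bpoly mu b i k) (mu ! k + l - p))"
    using assms by (intro sum.mono_neutral_right) (auto simp: coeff_bpoly max_def)
  finally show ?thesis .
qed

lemma coeff_slice_entry:
  "poly.coeff (slice_entry mu b i j) l =
     (if i = j \<and> l = mu ! i then 1 else 0) - poly.coeff (bpoly mu b i j) l +
     (\<Sum>k\<in>{max j (Suc i)..<length mu}. \<Sum>p<mu ! k.
        poly.coeff (bpoly mu b k j) p * poly.coeff (bpoly mu b i k) (mu ! k + l - p))"
  unfolding slice_entry_def by (simp add: coeff_sum coeff_bpoly_mult_shift)

abbreviation b_param :: "nat list \<Rightarrow> complex poly mat \<Rightarrow> nat \<times> nat \<times> nat \<Rightarrow> complex" where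
  "b_param mu A \<equiv> (\<lambda>(i, j, l). b_coeff mu A i j l)"

lemma b_coeff_outside:
  "\<not> (i < length mu \<and> j < length mu \<and> l < mu ! max i j) \<Longrightarrow> b_coeff mu A i j l = 0"
  by (subst b_coeff.simps) (simp only: if_False)

lemma b_param_in_param_space: "b_param mu A \<in> param_space mu"
  by (auto simp: affine_space_def param_index_def intro: b_coeff_outside)

lemma coeff_bpoly_param:
  assumes "b \<in> param_space mu" "i < length mu" "j < length mu"
  shows "poly.coeff (bpoly mu b i j) l = b (i, j, l)"
  using assms by (auto simp: coeff_bpoly affine_space_def param_index_def)

text \<open>In both cases of the recursion the sum runs over the \<open>k\<close> with \<open>k \<ge> j\<close> and \<open>k > i\<close>.\<close>

lemma b_coeff_rec:
  assumes "i < length mu" "j < length mu" "l < mu ! max i j"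
  shows "b_coeff mu A i j l = a_coeff A i j l +
    (\<Sum>k\<in>{max j (Suc i)..<length mu}. \<Sum>p<mu ! k.
       b_coeff mu A k j p * b_coeff mu A i k (mu ! k + l - p))"
proof -
  have "{i<..<length mu} = {Suc i..<length mu}" by auto
  moreover have "max j (Suc i) = (if j \<le> i then Suc i else j)" by auto
  ultimately show ?thesis
    using assms by (subst b_coeff.simps) simp
qed

text \<open>In degrees below \<open>\<mu>\<close> at the larger index, the formula for the coefficients of the slice matrix,
  solved for the linear term \<open>b\<close>, is the recursion that defines the \<open>b\<close> of a matrix.\<close>

lemma b_coeff_slice_mat:
  assumes "b \<in> param_space mu" "A = slice_mat mu b"
  shows "b_coeff mu A i j l = b (i, j, l)"
  using assms
proof (induction mu A i j l rule: b_coeff.induct)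
  case (1 mu A i j l)
  note b = "1.prems"(1)
  show ?case
  proof (cases "i < length mu \<and> j < length mu \<and> l < mu ! max i j")
    case True
    have c: "poly.coeff (bpoly mu b i j) l = b (i, j, l)" if "i < length mu" "j < length mu" for i j l
      by (rule coeff_bpoly_param[OF b that])
    have IH: "b_coeff mu A k j p = b (k, j, p) \<and>
        b_coeff mu A i k (mu ! k + l - p) = b (i, k, mu ! k + l - p)"
      if k: "k \<in> {max j (Suc i)..<length mu}" and p: "p < mu ! k" for k p
    proof (cases "j \<le> i")
      case le: True
      show ?thesis
        using "1.IH"(1,2)[OF True le, of k p] k p "1.prems" by auto
    next
      case gt: False
      show ?thesis
        using "1.IH"(3,4)[OF True gt, of k p] k p "1.prems" by auto
    qed
    have "b_coeff mu A i j l = a_coeff A i j l +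
        (\<Sum>k\<in>{max j (Suc i)..<length mu}. \<Sum>p<mu ! k. b (k, j, p) * b (i, k, mu ! k + l - p))"
      using True IH by (subst b_coeff_rec) (auto intro!: sum.cong)
    also have "a_coeff A i j l = b (i, j, l) -
        (\<Sum>k\<in>{max j (Suc i)..<length mu}. \<Sum>p<mu ! k. b (k, j, p) * b (i, k, mu ! k + l - p))"
    proof -
      have "a_coeff A i j l = - poly.coeff (slice_entry mu b i j) l"
        using True by (simp add: a_coeff_def "1.prems"(2) slice_mat_def)
      also have "\<dots> = b (i, j, l) -
          (\<Sum>k\<in>{max j (Suc i)..<length mu}. \<Sum>p<mu ! k. b (k, j, p) * b (i, k, mu ! k + l - p))"
        using True unfolding coeff_slice_entry by (auto simp: c)
      finally show ?thesis .
    qed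
    finally show ?thesis by simp
  next
    case False
    then show ?thesis
      using b by (simp add: b_coeff_outside affine_space_def param_index_def)
  qed
qed

text \<open>Both sides lie in the slice, and the recursion for \<open>b\<close> says that they have the same low
  coefficients. That the high coefficients agree as well is where membership in the slice enters.\<close>

lemma slice_mat_b_param:
  assumes A: "A \<in> W_slice mu"
  shows "slice_mat mu (b_param mu A) = A"
proof (rule W_slice_eqI[OF slice_mat_in_W_slice A])
  fix i j l
  assume ij: "i < length mu" "j < length mu" "l < mu ! max i j"
  let ?b = "b_param mu A"
  have c: "poly.coeff (bpoly mu ?b i j) l = b_coeff mu A i j l" if "i < length mu" "j < length mu" for i j l
    using coeff_bpoly_param[OF b_param_in_param_space that] by simp
  have "poly.coeff (slice_mat mu ?b $$ (i, j)) l = - b_coeff mu A i j l +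
     (\<Sum>k\<in>{max j (Suc i)..<length mu}. \<Sum>p<mu ! k.
       b_coeff mu A k j p * b_coeff mu A i k (mu ! k + l - p))"
    using ij unfolding slice_mat_def by (auto simp: coeff_slice_entry c simp del: mult_eq_0_iff)
  also have "\<dots> = - a_coeff A i j l"
    using b_coeff_rec[OF ij, of A] by simp
  also have "\<dots> = poly.coeff (A $$ (i, j)) l"
    by (simp add: a_coeff_def)
  finally show "poly.coeff (slice_mat mu ?b $$ (i, j)) l = poly.coeff (A $$ (i, j)) l" .
qed

section \<open>Block indices\<close>

definition block_index :: "nat list \<Rightarrow> (nat \<times> nat) list" where
  "block_index mu = concat (map (\<lambda>i. map (Pair i) [0..<mu ! i]) [0..<length mu])"

lemma length_block_index: "length (block_index mu) = sum_list mu"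
  by (simp add: block_index_def length_concat comp_def map_nth)

lemma set_block_index: "set (block_index mu) = (SIGMA i:{..<length mu}. {..<mu ! i})"
  by (auto simp: block_index_def)

lemma nth_concat_offset:
  assumes "i < length xss" "k < length (xss ! i)"
  shows "sum_list (map length (take i xss)) + k < length (concat xss) \<and>
    concat xss ! (sum_list (map length (take i xss)) + k) = xss ! i ! k"
proof -
  have "concat xss = concat (take i xss) @ xss ! i @ concat (drop (Suc i) xss)"
    by (subst id_take_nth_drop[OF assms(1)]) simp
  then show ?thesis
    using assms(2) by (simp add: length_concat[symmetric] nth_append)
qed

lemma block_index_offset:
  assumes "i < length mu" "k < mu ! i"
  shows "offset mu i + k < sum_list mu" "block_index mu ! (offset mu i + k) = (i, k)"
proof -
  let ?xss = "map (\<lambda>i. map (Pair i) [0..<mu ! i]) [0..<length mu]"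
  have "map length (take i ?xss) = take i mu"
    using assms by (intro nth_equalityI) auto
  then have "sum_list (map length (take i ?xss)) = offset mu i"
    by (simp only: offset_def)
  moreover have "i < length ?xss" "k < length (?xss ! i)" "?xss ! i ! k = (i, k)"
    using assms by simp_all
  ultimately have "offset mu i + k < length (concat ?xss) \<and> concat ?xss ! (offset mu i + k) = (i, k)"
    using nth_concat_offset[of i ?xss k] by (simp only:)
  then show "offset mu i + k < sum_list mu" "block_index mu ! (offset mu i + k) = (i, k)"
    unfolding block_index_def[symmetric] length_block_index by blast+
qed

lemma distinct_block_index: "distinct (block_index mu)"
proof (rule card_distinct)
  have "card (set (block_index mu)) = (\<Sum>i<length mu. mu ! i)"
    unfolding set_block_index by (subst card_SigmaI) simp_all
  then show "card (set (block_index mu)) = length (block_index mu)"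
    by (simp add: length_block_index sum_list_sum_nth atLeast0LessThan)
qed

lemma block_index_cases:
  assumes "r < sum_list mu"
  obtains i k where "i < length mu" "k < mu ! i" "r = offset mu i + k"
proof -
  have "block_index mu ! r \<in> set (block_index mu)"
    using assms by (simp add: length_block_index)
  then obtain i k where ik: "block_index mu ! r = (i, k)" "i < length mu" "k < mu ! i"
    by (auto simp: set_block_index)
  then have "block_index mu ! r = block_index mu ! (offset mu i + k)"
    using block_index_offset(2)[OF ik(2,3)] by simp
  then have "r = offset mu i + k"
    using nth_eq_iff_index_eq[OF distinct_block_index, of r mu "offset mu i + k"]
      assms block_index_offset(1)[OF ik(2,3)] by (simp add: length_block_index)
  with ik that show ?thesis by blast
qed

lemma offset_inject:
  assumes "i < length mu" "k < mu ! i" "j < length mu" "m < mu ! j"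
  shows "offset mu i + k = offset mu j + m \<longleftrightarrow> i = j \<and> k = m"
  using block_index_offset(2)[OF assms(1,2)] block_index_offset(2)[OF assms(3,4)]
  by (metis prod.inject)

lemma sum_block_index:
  "(\<Sum>r<sum_list mu. f r) = (\<Sum>i<length mu. \<Sum>k<mu ! i. f (offset mu i + k))"
proof -
  have "(\<Sum>r<sum_list mu. f r) =
      (\<Sum>(i, k)\<in>(SIGMA i:{..<length mu}. {..<mu ! i}). f (offset mu i + k))"
  proof (rule sum.reindex_bij_witness[where i = "\<lambda>(i, k). offset mu i + k" and j = "nth (block_index mu)"])
    fix r assume "r \<in> {..<sum_list mu}"
    then have "r < sum_list mu" by simp
    then obtain i k where "i < length mu" "k < mu ! i" "r = offset mu i + k"
      by (rule block_index_cases)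
    then show "(case block_index mu ! r of (i, k) \<Rightarrow> offset mu i + k) = r"
      "block_index mu ! r \<in> (SIGMA i:{..<length mu}. {..<mu ! i})"
      "(case block_index mu ! r of (i, k) \<Rightarrow> f (offset mu i + k)) = f r"
      by (auto simp: block_index_offset)
  qed (auto simp: block_index_offset)
  then show ?thesis by (simp add: sum.Sigma)
qed

section \<open>Parametrization of \<open>S\<^sub>\<mu>\<close> by the same parameters\<close>

text \<open>Column \<open>(i, m)\<close> expresses \<open>x v\<^sub>i\<^sub>,\<^sub>m\<close> in the basis \<open>v\<close>. The recursion for the \<open>v\<close> contributes the coefficient of
  degree \<open>\<mu>\<^sub>i - 1 - m\<close> of \<open>b\<^sub>j\<^sub>,\<^sub>i\<close> at \<open>v\<^sub>j\<^sub>,\<^sub>0\<close> for \<open>j < i\<close>, which is why the first row of an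
  upper block lists the coefficients in reverse order.\<close>

definition comp_entry ::
  "nat list \<Rightarrow> (nat \<times> nat \<times> nat \<Rightarrow> complex) \<Rightarrow> nat \<times> nat \<Rightarrow> nat \<times> nat \<Rightarrow> complex" where
  "comp_entry mu b = (\<lambda>(j, k) (i, m).
     if j < i then (if k = 0 then b (j, i, mu ! i - 1 - m) else 0)
     else if m = mu ! i - 1 then b (j, i, k)
     else if j = i \<and> k = Suc m then 1 else 0)"

definition comp_mat :: "nat list \<Rightarrow> (nat \<times> nat \<times> nat \<Rightarrow> complex) \<Rightarrow> complex mat" where
  "comp_mat mu b = mat (sum_list mu) (sum_list mu)
     (\<lambda>(r, c). comp_entry mu b (block_index mu ! r) (block_index mu ! c))"

definition S_param :: "nat list \<Rightarrow> complex mat \<Rightarrow> nat \<times> nat \<times> nat \<Rightarrow> complex" where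
  "S_param mu M = (\<lambda>(i, j, l).
     if (i, j, l) \<in> param_index mu
     then if i < j then M $$ (offset mu i, offset mu j + (mu ! j - 1 - l))
          else M $$ (offset mu i + l, offset mu j + (mu ! j - 1))
     else 0)"

lemma comp_mat_carrier: "comp_mat mu b \<in> carrier_mat (sum_list mu) (sum_list mu)"
  by (simp add: comp_mat_def)

lemma comp_mat_index:
  assumes "j < length mu" "k < mu ! j" "i < length mu" "m < mu ! i"
  shows "comp_mat mu b $$ (offset mu j + k, offset mu i + m) = comp_entry mu b (j, k) (i, m)"
  using assms by (simp add: comp_mat_def block_index_offset)

lemma comp_mat_in_S_slice: "comp_mat mu b \<in> S_slice mu"
  unfolding S_slice_def is_companion_def block_def
  using comp_mat_carrier[of mu b] by (auto simp: comp_mat_index comp_entry_def)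

lemma S_param_in_param_space: "S_param mu M \<in> param_space mu"
  by (auto simp: S_param_def affine_space_def)

lemma S_param_comp_mat:
  assumes pos: "\<And>i. i < length mu \<Longrightarrow> 1 \<le> mu ! i" and b: "b \<in> param_space mu"
  shows "S_param mu (comp_mat mu b) = b"
proof (rule ext, clarify)
  fix i j l
  show "S_param mu (comp_mat mu b) (i, j, l) = b (i, j, l)"
  proof (cases "(i, j, l) \<in> param_index mu")
    case True
    then have ij: "i < length mu" "j < length mu" "l < mu ! max i j"
      by (auto simp: param_index_def)
    note p = pos[OF ij(1)] pos[OF ij(2)]
    show ?thesis
    proof (cases "i < j")
      case lt: True
      then show ?thesis
        using True ij p comp_mat_index[of i mu 0 j "mu ! j - 1 - l" b]
        by (simp add: S_param_def comp_entry_def)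
    next
      case False
      then show ?thesis
        using True ij p comp_mat_index[of i mu l j "mu ! j - 1" b]
        by (simp add: S_param_def comp_entry_def)
    qed
  qed (use b in \<open>auto simp: S_param_def affine_space_def\<close>)
qed

lemma comp_mat_S_param:
  assumes pos: "\<And>i. i < length mu \<Longrightarrow> 1 \<le> mu ! i" and M: "M \<in> S_slice mu"
  shows "comp_mat mu (S_param mu M) = M"
proof (rule eq_matI)
  have Mc: "M \<in> carrier_mat (sum_list mu) (sum_list mu)"
    using M by (simp add: S_slice_def)
  then show "dim_row (comp_mat mu (S_param mu M)) = dim_row M"
    "dim_col (comp_mat mu (S_param mu M)) = dim_col M"
    by (simp_all add: comp_mat_def)
  fix r c
  assume "r < dim_row M" "c < dim_col M"
  then have "r < sum_list mu" "c < sum_list mu" using Mc by auto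
  obtain j k where jk: "j < length mu" "k < mu ! j" "r = offset mu j + k"
    using block_index_cases[OF \<open>r < sum_list mu\<close>] .
  obtain i m where im: "i < length mu" "m < mu ! i" "c = offset mu i + m"
    using block_index_cases[OF \<open>c < sum_list mu\<close>] .
  have blk: "block mu M j i $$ (k, m) = M $$ (r, c)"
    using jk im by (simp add: block_def)
  have lower: "M $$ (r, c) = 0" if "i < j" "m < mu ! i - 1"
    using M jk im that unfolding S_slice_def blk[symmetric] by auto
  have upper: "M $$ (r, c) = 0" if "j < i" "0 < k"
    using M jk im that unfolding S_slice_def blk[symmetric] by auto
  have diag: "M $$ (r, c) = (if k = m + 1 then 1 else 0)" if "j = i" "m < mu ! i - 1"
  proof -
    have "is_companion (block mu M j i)"
      using M jk im that by (auto simp: S_slice_def)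
    then show ?thesis
      using jk im that unfolding is_companion_def blk[symmetric] by (simp add: block_def)
  qed
  have "comp_mat mu (S_param mu M) $$ (r, c) = comp_entry mu (S_param mu M) (j, k) (i, m)"
    using jk im by (simp add: comp_mat_index)
  also have "\<dots> = M $$ (r, c)"
  proof (cases "j < i")
    case True
    then show ?thesis
      using upper jk im by (auto simp: comp_entry_def S_param_def param_index_def)
  next
    case False
    show ?thesis
    proof (cases "m = mu ! i - 1")
      case True
      then show ?thesis
        using False jk im by (auto simp: comp_entry_def S_param_def param_index_def max_def)
    next
      case ml: False
      then have "m < mu ! i - 1" using im by linarith
      then show ?thesis
        using False ml lower diag by (cases "j = i") (auto simp: comp_entry_def)
    qed
  qed
  finally show "comp_mat mu (S_param mu M) $$ (r, c) = M $$ (r, c)" .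
qed


section \<open>Polynomial functions and parametrized varieties\<close>

lemma polynomial_fun_compose:
  assumes "polynomial_fun f" "\<And>i. polynomial_fun (\<lambda>z. h z i)"
  shows "polynomial_fun (\<lambda>z. f (h z))"
  using assms by (induction rule: polynomial_fun.induct) (auto intro: polynomial_fun.intros)

lemma polynomial_fun_sum:
  "(\<And>i. i \<in> S \<Longrightarrow> polynomial_fun (f i)) \<Longrightarrow> polynomial_fun (\<lambda>z. \<Sum>i\<in>S. f i z)"
  by (induction S rule: infinite_finite_induct) (auto intro: polynomial_fun.intros)

lemma polynomial_fun_minus: "polynomial_fun f \<Longrightarrow> polynomial_fun (\<lambda>z. - f z)"
  using polynomial_fun.mult[OF polynomial_fun.const[of "- 1"], of f] by simp

lemma polynomial_fun_diff:
  "polynomial_fun f \<Longrightarrow> polynomial_fun g \<Longrightarrow> polynomial_fun (\<lambda>z. f z - g z)"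
  using polynomial_fun.add[OF _ polynomial_fun_minus, of f g] by simp

lemma polynomial_fun_if:
  "polynomial_fun f \<Longrightarrow> polynomial_fun g \<Longrightarrow> polynomial_fun (\<lambda>z. if P then f z else g z)"
  by (cases P) simp_all

text \<open>A chart is an isomorphism \<open>F\<close>, with inverse \<open>R\<close>, from an affine space to the set \<open>X\<close>. That
  \<open>X\<close> is closed is a consequence.\<close>

definition polynomial_chart ::
  "('p \<Rightarrow> 'i \<Rightarrow> complex) \<Rightarrow> 'p set \<Rightarrow> 't set \<Rightarrow> (('t \<Rightarrow> complex) \<Rightarrow> 'p) \<Rightarrow> ('p \<Rightarrow> 't \<Rightarrow> complex) \<Rightarrow> bool" where
  "polynomial_chart \<kappa> X J F R \<longleftrightarrow>
     inj_on \<kappa> X \<and> (\<exists>I. finite I \<and> (\<forall>P\<in>X. \<forall>i. i \<notin> I \<longrightarrow> \<kappa> P i = 0)) \<and>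
     (\<forall>b\<in>affine_space J. F b \<in> X \<and> R (F b) = b) \<and>
     (\<forall>P\<in>X. R P \<in> affine_space J \<and> F (R P) = P) \<and>
     (\<forall>i. \<exists>g. polynomial_fun g \<and> (\<forall>b\<in>affine_space J. \<kappa> (F b) i = g b)) \<and>
     (\<forall>t. \<exists>g. polynomial_fun g \<and> (\<forall>P\<in>X. R P t = g (\<kappa> P)))"

lemma polynomial_chartD:
  assumes "polynomial_chart \<kappa> X J F R"
  shows "inj_on \<kappa> X"
    and "\<exists>I. finite I \<and> (\<forall>P\<in>X. \<forall>i. i \<notin> I \<longrightarrow> \<kappa> P i = 0)"
    and "\<forall>b\<in>affine_space J. F b \<in> X \<and> R (F b) = b"
    and "\<forall>P\<in>X. R P \<in> affine_space J \<and> F (R P) = P"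
    and "\<forall>i. \<exists>g. polynomial_fun g \<and> (\<forall>b\<in>affine_space J. \<kappa> (F b) i = g b)"
    and "\<forall>t. \<exists>g. polynomial_fun g \<and> (\<forall>P\<in>X. R P t = g (\<kappa> P))"
  using assms unfolding polynomial_chart_def by - ((elim conjE, assumption)+)

text \<open>The polynomial formulas for \<open>R\<close> make sense on the whole ambient space, and followed by \<open>F\<close> they
  retract it onto \<open>X\<close>. The fixed points of a polynomial retraction are a closed set.\<close>

lemma polynomial_chart_affine_variety:
  assumes c: "polynomial_chart \<kappa> X J F R"
  shows "affine_variety \<kappa> X"
proof -
  note D = polynomial_chartD[OF c]
  from D(2) obtain I where I: "finite I" "\<forall>P\<in>X. \<forall>i. i \<notin> I \<longrightarrow> \<kappa> P i = 0"
    by (elim exE conjE)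
  from choice[OF D(5)] obtain G where
    G': "\<forall>i. polynomial_fun (G i) \<and> (\<forall>b\<in>affine_space J. \<kappa> (F b) i = G i b)"
    by (elim exE)
  then have G: "polynomial_fun (G i)" "b \<in> affine_space J \<Longrightarrow> \<kappa> (F b) i = G i b" for i b
    by simp_all
  from choice[OF D(6)] obtain H where
    H': "\<forall>t. polynomial_fun (H t) \<and> (\<forall>P\<in>X. R P t = H t (\<kappa> P))"
    by (elim exE)
  then have H: "polynomial_fun (H t)" "P \<in> X \<Longrightarrow> R P t = H t (\<kappa> P)" for t P
    by simp_all
  have F: "F b \<in> X" if "b \<in> affine_space J" for b
    using D(3) that by simp
  have R: "R P \<in> affine_space J" "F (R P) = P" if "P \<in> X" for P
    using D(4) that by simp_all
  \<comment> \<open>the extension of \<open>R\<close>, cut off outside \<open>J\<close> so that it takes values in the affine space at points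
    that are not in \<open>X\<close> as well\<close>
  define \<beta> where "\<beta> z t = (if t \<in> J then H t z else 0)" for z t
  have \<beta>: "\<beta> z \<in> affine_space J" for z
    by (simp add: \<beta>_def affine_space_def)
  have \<beta>R: "\<beta> (\<kappa> P) = R P" if "P \<in> X" for P
    using R(1)[OF that] H(2)[OF that] by (auto simp: \<beta>_def affine_space_def)
  have p\<beta>: "polynomial_fun (\<lambda>z. \<beta> z t)" for t
    using H(1) polynomial_fun.const by (cases "t \<in> J") (auto simp: \<beta>_def)
  let ?E = "range (\<lambda>i z. z i - G i (\<beta> z))"
  have "\<kappa> ` X = {z. (\<forall>i. i \<notin> I \<longrightarrow> z i = 0) \<and> (\<forall>f\<in>?E. f z = 0)}"
  proof (intro equalityI subsetI)
    fix z assume "z \<in> \<kappa> ` X"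
    then obtain P where P: "P \<in> X" "z = \<kappa> P" by blast
    then have "z i - G i (\<beta> z) = 0" for i
      using G(2)[of "R P" i] R[OF P(1)] \<beta>R[OF P(1)] by simp
    then show "z \<in> {z. (\<forall>i. i \<notin> I \<longrightarrow> z i = 0) \<and> (\<forall>f\<in>?E. f z = 0)}"
      using P I(2) by auto
  next
    fix z assume "z \<in> {z. (\<forall>i. i \<notin> I \<longrightarrow> z i = 0) \<and> (\<forall>f\<in>?E. f z = 0)}"
    then have "z = \<kappa> (F (\<beta> z))"
      using G(2)[OF \<beta>] by auto
    then show "z \<in> \<kappa> ` X" using F[OF \<beta>] by blast
  qed
  moreover have "\<forall>f\<in>?E. polynomial_fun f"
    by (auto intro!: polynomial_fun_diff polynomial_fun.coord polynomial_fun_compose[OF G(1) p\<beta>])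
  ultimately have "zariski_closed (\<kappa> ` X)"
    unfolding zariski_closed_def using I(1) by blast
  then show ?thesis
    using D(1) by (simp add: affine_variety_def)
qed

lemma polynomial_chart_regular_map:
  assumes c: "polynomial_chart \<kappa> X J F R" and c': "polynomial_chart \<kappa>' Y J F' R'"
    and f: "\<And>P. P \<in> X \<Longrightarrow> f P = F' (R P)"
  shows "regular_map \<kappa> X \<kappa>' Y f"
proof -
  note D = polynomial_chartD[OF c] and D' = polynomial_chartD[OF c']
  have R: "R P \<in> affine_space J" if "P \<in> X" for P
    using D(4) that by simp
  have F': "F' b \<in> Y" if "b \<in> affine_space J" for b
    using D'(3) that by simp
  from choice[OF D(6)] obtain h where
    h': "\<forall>t. polynomial_fun (h t) \<and> (\<forall>P\<in>X. R P t = h t (\<kappa> P))"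
    by (elim exE)
  then have h: "polynomial_fun (h t)" "P \<in> X \<Longrightarrow> R P t = h t (\<kappa> P)" for t P
    by simp_all
  have hR: "(\<lambda>t. h t (\<kappa> P)) = R P" if "P \<in> X" for P
    using h(2)[OF that] by auto
  have "\<exists>g. polynomial_fun g \<and> (\<forall>P\<in>X. \<kappa>' (f P) i = g (\<kappa> P))" for i
  proof -
    from D'(5)[rule_format, of i] obtain g where
      g: "polynomial_fun g" "\<forall>b\<in>affine_space J. \<kappa>' (F' b) i = g b"
      by (elim exE conjE)
    have "polynomial_fun (\<lambda>z. g (\<lambda>t. h t z))"
      by (rule polynomial_fun_compose[OF g(1) h(1)])
    moreover have "\<forall>P\<in>X. \<kappa>' (f P) i = g (\<lambda>t. h t (\<kappa> P))"
      using g(2) R f hR by simp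
    ultimately show ?thesis by (intro exI[of _ "\<lambda>z. g (\<lambda>t. h t z)"]) simp
  qed
  then show ?thesis
    using F' R f by (auto simp: regular_map_def)
qed

lemma polynomial_chart_isomorphism:
  assumes c: "polynomial_chart \<kappa> X J F R" and c': "polynomial_chart \<kappa>' Y J F' R'"
    and f: "\<And>P. P \<in> X \<Longrightarrow> f P = F' (R P)"
  shows "variety_isomorphism \<kappa> X \<kappa>' Y f"
proof -
  note D = polynomial_chartD[OF c] and D' = polynomial_chartD[OF c']
  have "(\<forall>P\<in>X. F (R' (f P)) = P) \<and> (\<forall>Q\<in>Y. f (F (R' Q)) = Q)"
    using f D(3,4) D'(3,4) by simp
  moreover have "regular_map \<kappa>' Y \<kappa> X (\<lambda>Q. F (R' Q))"
    by (rule polynomial_chart_regular_map[OF c' c]) simp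
  ultimately show ?thesis
    unfolding variety_isomorphism_def
    using polynomial_chart_affine_variety[OF c] polynomial_chart_affine_variety[OF c']
      polynomial_chart_regular_map[OF c c' f] by blast
qed

section \<open>The chart of the slice\<close>

text \<open>One polynomial serves all matrices, because the shape of the recursion depends only on \<open>\<mu>\<close> and
  the indices.\<close>

lemma b_coeff_polynomial:
  "\<exists>g. polynomial_fun g \<and>
    (\<forall>A\<in>carrier_mat (length mu) (length mu). b_coeff mu A i j l = g (poly_mat_coords A))"
  \<comment> \<open>the induction rule follows the recursion at one matrix, which can be any\<close>
proof (induction mu "undefined :: complex poly mat" i j l rule: b_coeff.induct)
  case (1 mu i j l)
  show ?case
  proof (cases "i < length mu \<and> j < length mu \<and> l < mu ! max i j")
    case True
    let ?S = "SIGMA k:{max j (Suc i)..<length mu}. {..<mu ! k}"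
    let ?P = "\<lambda>i j l g. polynomial_fun g \<and>
      (\<forall>A\<in>carrier_mat (length mu) (length mu). b_coeff mu A i j l = g (poly_mat_coords A))"
    have IH: "(\<exists>g. ?P k j p g) \<and> (\<exists>h. ?P i k (mu ! k + l - p) h)"
      if k: "k \<in> {max j (Suc i)..<length mu}" and p: "p < mu ! k" for k p
    proof (cases "j \<le> i")
      case le: True
      show ?thesis
        using 1(1,2)[OF True le, of k p] k p by auto
    next
      case gt: False
      show ?thesis
        using 1(3,4)[OF True gt, of k p] k p by auto
    qed
    then have "\<forall>s\<in>?S. \<exists>g. ?P (fst s) j (snd s) g" "\<forall>s\<in>?S. \<exists>h. ?P i (fst s) (mu ! fst s + l - snd s) h"
      by auto
    note choices = this[THEN bchoice]
    from choices(1) obtain g where g: "\<forall>s\<in>?S. ?P (fst s) j (snd s) (g s)" by (elim exE)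
    from choices(2) obtain h where h: "\<forall>s\<in>?S. ?P i (fst s) (mu ! fst s + l - snd s) (h s)" by (elim exE)
    have gh: "?P k j p (g (k, p))" "?P i k (mu ! k + l - p) (h (k, p))"
      if "k \<in> {max j (Suc i)..<length mu}" "p \<in> {..<mu ! k}" for k p
      using bspec[OF g, of "(k, p)"] bspec[OF h, of "(k, p)"] that by auto
    let ?f = "\<lambda>z. - z (i, j, l) + (\<Sum>k\<in>{max j (Suc i)..<length mu}. \<Sum>p<mu ! k. g (k, p) z * h (k, p) z)"
    have "polynomial_fun ?f"
      using gh by (intro polynomial_fun.add polynomial_fun_minus polynomial_fun.coord
          polynomial_fun_sum polynomial_fun.mult) blast+
    moreover have "b_coeff mu A i j l = ?f (poly_mat_coords A)"
      if A: "A \<in> carrier_mat (length mu) (length mu)" for A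
    proof -
      have "b_coeff mu A k j p * b_coeff mu A i k (mu ! k + l - p) =
          g (k, p) (poly_mat_coords A) * h (k, p) (poly_mat_coords A)"
        if "k \<in> {max j (Suc i)..<length mu}" "p \<in> {..<mu ! k}" for k p
        using gh[OF that] A by simp
      moreover have "a_coeff A i j l = - poly_mat_coords A (i, j, l)"
        using A True by (simp add: a_coeff_def poly_mat_coords_def)
      ultimately show ?thesis
        using True by (subst b_coeff_rec) (auto intro!: sum.cong)
    qed
    ultimately show ?thesis by (intro exI[of _ ?f]) simp
  next
    case False
    then show ?thesis
      by (intro exI[of _ "\<lambda>z. 0"]) (auto simp: b_coeff_outside intro: polynomial_fun.const)
  qed
qed

lemma inj_on_poly_mat_coords: "inj_on poly_mat_coords (carrier_mat n m)"
proof (rule inj_onI, rule eq_matI)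
  fix A B :: "complex poly mat" and i j
  assume A: "A \<in> carrier_mat n m" and B: "B \<in> carrier_mat n m"
    and eq: "poly_mat_coords A = poly_mat_coords B"
    and ij: "i < dim_row B" "j < dim_col B"
  show "A $$ (i, j) = B $$ (i, j)"
  proof (rule poly_eqI)
    fix l
    show "poly.coeff (A $$ (i, j)) l = poly.coeff (B $$ (i, j)) l"
      using fun_cong[OF eq, of "(i, j, l)"] A B ij by (simp add: poly_mat_coords_def)
  qed
qed auto

text \<open>The degree bound holds since \<open>\<mu>\<^sub>k\<close> exceeds the degree of both factors in a product that is divided
  by \<open>x\<close> to the power \<open>\<mu>\<^sub>k\<close>.\<close>

lemma slice_mat_polynomial_chart:
  "polynomial_chart poly_mat_coords (W_slice mu) (param_index mu) (slice_mat mu) (b_param mu)"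
proof -
  let ?n = "length mu"
  let ?\<kappa> = "poly_mat_coords"
  let ?X = "W_slice mu"
  have sub: "?X \<subseteq> carrier_mat ?n ?n"
    by (auto simp: W_slice_def)
  have coord: "?\<kappa> (slice_mat mu b) (i, j, l) = (if i < ?n \<and> j < ?n then poly.coeff (slice_entry mu b i j) l else 0)"
    for b i j l
    by (simp add: poly_mat_coords_def slice_mat_def)
  have bound: "poly.coeff (slice_entry mu b i j) l = 0"
    if "i < ?n" "j < ?n" "sum_list mu < l" for b i j l
  proof -
    have le: "mu ! k \<le> sum_list mu" if "k < ?n" for k
      using that by (intro member_le_sum_list) auto
    have "poly.coeff (bpoly mu b i k) (mu ! k + l - p) = 0" if "k \<in> {max j (Suc i)..<?n}" "p < mu ! k" for k p
    proof -
      have "max i k = k" using that by simp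
      then show ?thesis
        using that le[of k] \<open>sum_list mu < l\<close> by (simp add: coeff_bpoly)
    qed
    then show ?thesis
      using that le[of i] le[of "max i j"] unfolding coeff_slice_entry
      by (auto simp: coeff_bpoly max_def intro!: sum.neutral)
  qed
  have F: "\<forall>b\<in>affine_space (param_index mu). slice_mat mu b \<in> ?X \<and> b_param mu (slice_mat mu b) = b"
    by (auto simp: slice_mat_in_W_slice b_coeff_slice_mat fun_eq_iff)
  moreover have R: "\<forall>A\<in>?X. b_param mu A \<in> affine_space (param_index mu) \<and> slice_mat mu (b_param mu A) = A"
    by (simp add: slice_mat_b_param b_param_in_param_space)
  moreover have "inj_on ?\<kappa> ?X"
    by (rule inj_on_subset[OF inj_on_poly_mat_coords sub])
  moreover have "\<exists>I. finite I \<and> (\<forall>A\<in>?X. \<forall>t. t \<notin> I \<longrightarrow> ?\<kappa> A t = 0)"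
  proof (intro exI conjI ballI allI impI)
    show "finite ({..<?n} \<times> {..<?n} \<times> {..sum_list mu})" by simp
    fix A t
    assume A: "A \<in> ?X" and t: "t \<notin> {..<?n} \<times> {..<?n} \<times> {..sum_list mu}"
    obtain i j l where "t = (i, j, l)" by (cases t)
    then have "?\<kappa> (slice_mat mu (b_param mu A)) t = 0"
      using t bound[of i j l] by (auto simp: coord)
    then show "?\<kappa> A t = 0" using R A by simp
  qed
  moreover have "\<exists>g. polynomial_fun g \<and> (\<forall>b\<in>affine_space (param_index mu). ?\<kappa> (slice_mat mu b) t = g b)" for t
  proof -
    obtain i j l where t: "t = (i, j, l)" by (cases t)
    have B: "polynomial_fun (\<lambda>b. poly.coeff (bpoly mu b i j) l)" for i j l
      by (cases "l < mu ! max i j") (auto simp: coeff_bpoly intro: polynomial_fun.intros)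
    have "polynomial_fun (\<lambda>b. poly.coeff (slice_entry mu b i j) l)"
      unfolding coeff_slice_entry
      by (intro polynomial_fun.add polynomial_fun_diff polynomial_fun.const B
          polynomial_fun_sum polynomial_fun.mult)
    then have "polynomial_fun (\<lambda>b. if i < ?n \<and> j < ?n then poly.coeff (slice_entry mu b i j) l else 0)"
      by (cases "i < ?n \<and> j < ?n") (auto intro: polynomial_fun.const)
    then show ?thesis
      unfolding t coord by (rule exI[of _ "\<lambda>b. if i < ?n \<and> j < ?n then poly.coeff (slice_entry mu b i j) l else 0", OF conjI]) simp
  qed
  moreover have "\<exists>g. polynomial_fun g \<and> (\<forall>A\<in>?X. b_param mu A t = g (?\<kappa> A))" for t
  proof -
    obtain i j l where t: "t = (i, j, l)" by (cases t)
    show ?thesis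
      using b_coeff_polynomial[of mu i j l] sub unfolding t by auto
  qed
  ultimately show ?thesis
    unfolding polynomial_chart_def by (intro conjI allI)
qed

lemma inj_on_mat_coords: "inj_on mat_coords (carrier_mat n m)"
proof (rule inj_onI, rule eq_matI)
  fix A B :: "complex mat" and i j
  assume A: "A \<in> carrier_mat n m" and B: "B \<in> carrier_mat n m"
    and eq: "mat_coords A = mat_coords B"
    and ij: "i < dim_row B" "j < dim_col B"
  show "A $$ (i, j) = B $$ (i, j)"
    using fun_cong[OF eq, of "(i, j)"] A B ij by (simp add: mat_coords_def)
qed auto

lemma comp_mat_polynomial_chart:
  assumes pos: "\<And>i. i < length mu \<Longrightarrow> 1 \<le> mu ! i"
  shows "polynomial_chart mat_coords (S_slice mu) (param_index mu) (comp_mat mu) (S_param mu)"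
proof -
  let ?N = "sum_list mu"
  have sub: "S_slice mu \<subseteq> carrier_mat ?N ?N"
    by (auto simp: S_slice_def)
  have "inj_on mat_coords (S_slice mu)"
    by (rule inj_on_subset[OF inj_on_mat_coords sub])
  moreover have "\<exists>I. finite I \<and> (\<forall>M\<in>S_slice mu. \<forall>t. t \<notin> I \<longrightarrow> mat_coords M t = 0)"
    by (rule exI[of _ "{..<?N} \<times> {..<?N}"]) (use sub in \<open>auto simp: mat_coords_def\<close>)
  moreover have "\<forall>b\<in>affine_space (param_index mu). comp_mat mu b \<in> S_slice mu \<and> S_param mu (comp_mat mu b) = b"
    by (simp add: comp_mat_in_S_slice S_param_comp_mat[OF pos])
  moreover have "\<forall>M\<in>S_slice mu. S_param mu M \<in> affine_space (param_index mu) \<and> comp_mat mu (S_param mu M) = M"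
    by (simp add: S_param_in_param_space comp_mat_S_param[OF pos])
  moreover have "\<exists>g. polynomial_fun g \<and> (\<forall>b\<in>affine_space (param_index mu). mat_coords (comp_mat mu b) t = g b)" for t
  proof -
    obtain r c where t: "t = (r, c)" by (cases t)
    have e: "polynomial_fun (\<lambda>b. comp_entry mu b jk im)" for jk im
      unfolding comp_entry_def case_prod_beta
      by (intro polynomial_fun_if polynomial_fun.const polynomial_fun.coord)
    have "polynomial_fun (\<lambda>b. mat_coords (comp_mat mu b) t)"
    proof (cases "r < ?N \<and> c < ?N")
      case True
      then show ?thesis using e by (simp add: t mat_coords_def comp_mat_def)
    next
      case False
      then have "(\<lambda>b. mat_coords (comp_mat mu b) t) = (\<lambda>b. 0)"
        by (auto simp: t mat_coords_def comp_mat_def)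
      then show ?thesis by (simp add: polynomial_fun.const)
    qed
    then show ?thesis by (intro exI[of _ "\<lambda>b. mat_coords (comp_mat mu b) t"]) simp
  qed
  moreover have "\<exists>g. polynomial_fun g \<and> (\<forall>M\<in>S_slice mu. S_param mu M t = g (mat_coords M))" for t
  proof -
    obtain i j l where t: "t = (i, j, l)" by (cases t)
    show ?thesis
    proof (cases "t \<in> param_index mu")
      case False
      then show ?thesis
        by (intro exI[of _ "\<lambda>z. 0"]) (simp add: t S_param_def polynomial_fun.const)
    next
      case True
      then have ij: "i < length mu" "j < length mu" "l < mu ! max i j"
        by (auto simp: t param_index_def)
      define rc where "rc = (if i < j then (offset mu i, offset mu j + (mu ! j - 1 - l))
          else (offset mu i + l, offset mu j + (mu ! j - 1)))"
      have "fst rc < ?N \<and> snd rc < ?N"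
      proof (cases "i < j")
        case lt: True
        then show ?thesis
          using block_index_offset(1)[OF ij(1), of 0] block_index_offset(1)[OF ij(2), of "mu ! j - 1 - l"]
            pos[OF ij(1)] pos[OF ij(2)] by (simp add: rc_def)
      next
        case False
        then show ?thesis
          using block_index_offset(1)[OF ij(1), of l] block_index_offset(1)[OF ij(2), of "mu ! j - 1"]
            ij pos[OF ij(2)] by (simp add: rc_def)
      qed
      then have "\<forall>M\<in>S_slice mu. S_param mu M t = mat_coords M rc"
        using True sub by (auto simp: t S_param_def mat_coords_def rc_def split: if_splits)
      then show ?thesis
        by (intro exI[of _ "\<lambda>z. z rc"]) (simp add: polynomial_fun.coord)
    qed
  qed
  ultimately show ?thesis
    unfolding polynomial_chart_def by (intro conjI allI)
qed

section \<open>Vector spaces with coordinates\<close>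

lemma ordered_basis_vec_iff:
  fixes cs :: "'k :: field vec list"
  shows "ordered_basis (module_vec TYPE('k) N) cs \<longleftrightarrow>
    set cs \<subseteq> carrier_vec N \<and> length cs = N \<and> det (mat_of_cols N cs) \<noteq> 0"
proof -
  interpret W: vec_space "TYPE('k)" N .
  show ?thesis
  proof
    assume "ordered_basis (module_vec TYPE('k) N) cs"
    then have d: "distinct cs" and b: "W.basis (set cs)"
      by (auto simp: ordered_basis_def)
    then have sub: "set cs \<subseteq> carrier_vec N" and li: "W.lin_indpt (set cs)"
      by (auto simp: W.basis_def)
    have len: "length cs = N"
      using W.dim_basis[OF _ b] W.dim_is_n distinct_card[OF d] by simp
    have Pc: "mat_of_cols N cs \<in> carrier_mat N N"
      using mat_of_cols_carrier(1)[of N cs] unfolding len .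
    have "W.rank (mat_of_cols N cs) = N"
      by (rule W.lin_indpt_full_rank[OF Pc]) (use d li sub in simp_all)
    then have "det (mat_of_cols N cs) \<noteq> 0"
      using W.det_rank_iff[OF Pc] by blast
    then show "set cs \<subseteq> carrier_vec N \<and> length cs = N \<and> det (mat_of_cols N cs) \<noteq> 0"
      using sub len by blast
  next
    assume h: "set cs \<subseteq> carrier_vec N \<and> length cs = N \<and> det (mat_of_cols N cs) \<noteq> 0"
    let ?P = "mat_of_cols N cs"
    have P: "?P \<in> carrier_mat N N" using h by auto
    have cols: "cols ?P = cs" using h by simp
    have r: "W.rank ?P = N" using W.det_rank_iff[OF P] h by simp
    then have d: "distinct cs" using W.non_distinct_low_rank[OF P] cols by auto
    have li: "W.lin_indpt (set cs)"
      using W.full_rank_lin_indpt[OF P r] cols d by simp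
    have "W.basis (set cs)"
      using h d li by (intro W.dim_li_is_basis) (auto simp: W.dim_is_n distinct_card)
    then show "ordered_basis (module_vec TYPE('k) N) cs"
      using d by (simp add: ordered_basis_def W.vectorspace_axioms)
  qed
qed

text \<open>The vector space axioms of \<open>V\<close> are consequences, pulled back along the injective map \<open>\<psi>\<close>.\<close>

locale coordinates =
  fixes V :: "('k :: field, 'v) module" and N :: nat and \<psi> :: "'v \<Rightarrow> 'k vec"
  assumes bij: "bij_betw \<psi> (carrier V) (carrier_vec N)"
    and zero_closed: "\<zero>\<^bsub>V\<^esub> \<in> carrier V"
    and add_closed: "x \<in> carrier V \<Longrightarrow> y \<in> carrier V \<Longrightarrow> x \<oplus>\<^bsub>V\<^esub> y \<in> carrier V"
    and smult_closed: "x \<in> carrier V \<Longrightarrow> c \<odot>\<^bsub>V\<^esub> x \<in> carrier V"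
    and coord_zero: "\<psi> \<zero>\<^bsub>V\<^esub> = 0\<^sub>v N"
    and coord_add: "x \<in> carrier V \<Longrightarrow> y \<in> carrier V \<Longrightarrow> \<psi> (x \<oplus>\<^bsub>V\<^esub> y) = \<psi> x + \<psi> y"
    and coord_smult: "x \<in> carrier V \<Longrightarrow> \<psi> (c \<odot>\<^bsub>V\<^esub> x) = c \<cdot>\<^sub>v \<psi> x"
begin

lemma coord_closed: "x \<in> carrier V \<Longrightarrow> \<psi> x \<in> carrier_vec N"
  using bij by (auto simp: bij_betw_def)

lemma coord_eqI: "\<psi> x = \<psi> y \<Longrightarrow> x \<in> carrier V \<Longrightarrow> y \<in> carrier V \<Longrightarrow> x = y"
  using bij by (auto simp: bij_betw_def inj_on_def)

definition \<chi> :: "'k vec \<Rightarrow> 'v" where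
  "\<chi> = the_inv_into (carrier V) \<psi>"

lemma inv_closed: "v \<in> carrier_vec N \<Longrightarrow> \<chi> v \<in> carrier V"
  and coord_inv: "v \<in> carrier_vec N \<Longrightarrow> \<psi> (\<chi> v) = v"
  and inv_coord: "x \<in> carrier V \<Longrightarrow> \<chi> (\<psi> x) = x"
  using bij unfolding \<chi>_def bij_betw_def
  by (auto intro: the_inv_into_into f_the_inv_into_f the_inv_into_f_f)

lemma vectorspace: "vectorspace class_ring V"
proof (rule vs_criteria)
  show "field (class_ring :: 'k ring)" by (rule class_field)
  show "\<forall>v\<in>carrier V. \<exists>neg_v\<in>carrier V. v \<oplus>\<^bsub>V\<^esub> neg_v = \<zero>\<^bsub>V\<^esub>"
  proof
    fix v assume v: "v \<in> carrier V"
    have "v \<oplus>\<^bsub>V\<^esub> \<chi> (- \<psi> v) = \<zero>\<^bsub>V\<^esub>"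
      using v coord_closed[OF v]
      by (intro coord_eqI) (auto simp: coord_add coord_inv inv_closed coord_zero add_closed zero_closed
           minus_add_uminus_vec[symmetric])
    then show "\<exists>neg_v\<in>carrier V. v \<oplus>\<^bsub>V\<^esub> neg_v = \<zero>\<^bsub>V\<^esub>"
      using v coord_closed[OF v] by (intro bexI[of _ "\<chi> (- \<psi> v)"]) (auto intro: inv_closed)
  qed
  show "\<forall>v w. v \<in> carrier V \<and> w \<in> carrier V \<longrightarrow> v \<oplus>\<^bsub>V\<^esub> w = w \<oplus>\<^bsub>V\<^esub> v"
    using coord_closed
    by (intro allI impI coord_eqI) (auto simp: coord_add add_closed intro: comm_add_vec)
  show "\<forall>v w x. v \<in> carrier V \<and> w \<in> carrier V \<and> x \<in> carrier V \<longrightarrow>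
      v \<oplus>\<^bsub>V\<^esub> w \<oplus>\<^bsub>V\<^esub> x = v \<oplus>\<^bsub>V\<^esub> (w \<oplus>\<^bsub>V\<^esub> x)"
    using coord_closed
    by (intro allI impI coord_eqI) (auto simp: coord_add add_closed intro: assoc_add_vec)
  show "\<forall>v\<in>carrier V. v \<oplus>\<^bsub>V\<^esub> \<zero>\<^bsub>V\<^esub> = v"
    using coord_closed
    by (intro ballI coord_eqI) (auto simp: coord_add add_closed zero_closed coord_zero)
  show "\<forall>a b v. a \<in> carrier class_ring \<and> b \<in> carrier class_ring \<and> v \<in> carrier V \<longrightarrow>
      a \<otimes>\<^bsub>class_ring\<^esub> b \<odot>\<^bsub>V\<^esub> v = a \<odot>\<^bsub>V\<^esub> (b \<odot>\<^bsub>V\<^esub> v)"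
    by (intro allI impI coord_eqI) (auto simp: coord_smult smult_closed smult_smult_assoc class_ring_simps)
  show "\<forall>v\<in>carrier V. \<one>\<^bsub>class_ring\<^esub> \<odot>\<^bsub>V\<^esub> v = v"
    by (intro ballI coord_eqI) (auto simp: coord_smult smult_closed class_ring_simps)
  show "\<forall>a b v. a \<in> carrier class_ring \<and> b \<in> carrier class_ring \<and> v \<in> carrier V \<longrightarrow>
      (a \<oplus>\<^bsub>class_ring\<^esub> b) \<odot>\<^bsub>V\<^esub> v = a \<odot>\<^bsub>V\<^esub> v \<oplus>\<^bsub>V\<^esub> b \<odot>\<^bsub>V\<^esub> v"
    by (intro allI impI coord_eqI)
       (auto simp: coord_smult coord_add add_closed smult_closed class_ring_simps add_smult_distrib_vec)
  show "\<forall>a v w. a \<in> carrier class_ring \<and> v \<in> carrier V \<and> w \<in> carrier V \<longrightarrow>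
      a \<odot>\<^bsub>V\<^esub> (v \<oplus>\<^bsub>V\<^esub> w) = a \<odot>\<^bsub>V\<^esub> v \<oplus>\<^bsub>V\<^esub> a \<odot>\<^bsub>V\<^esub> w"
    using coord_closed
    by (intro allI impI coord_eqI)
       (auto simp: coord_smult coord_add add_closed smult_closed intro: smult_add_distrib_vec)
qed (auto simp: zero_closed add_closed smult_closed)

lemma coord_finsum:
  assumes "finite S" "f \<in> S \<rightarrow> carrier V" "i < N"
  shows "\<psi> (\<Oplus>\<^bsub>V\<^esub>r\<in>S. f r) $ i = (\<Sum>r\<in>S. \<psi> (f r) $ i)"
proof -
  interpret V: vectorspace class_ring V by (rule vectorspace)
  show ?thesis
    using assms
  proof (induction S rule: finite_induct)
    case empty
    then show ?case by (simp add: coord_zero)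
  next
    case (insert x S)
    then have "f x \<in> carrier V" "finsum V f S \<in> carrier V" by auto
    then show ?case
      using insert coord_closed[of "finsum V f S"] by (simp add: coord_add)
  qed
qed

lemma linear_map_coord: "linear_map class_ring V (module_vec TYPE('k) N) \<psi>"
proof -
  interpret V: vectorspace class_ring V by (rule vectorspace)
  interpret W: vectorspace class_ring "module_vec TYPE('k) N" by (rule vec_vs)
  show ?thesis
    by unfold_locales
       (auto simp: module_hom_def coord_closed coord_add coord_smult module_vec_simps)
qed

lemma linear_map_inv: "linear_map class_ring (module_vec TYPE('k) N) V \<chi>"
proof -
  interpret V: vectorspace class_ring V by (rule vectorspace)
  interpret W: vectorspace class_ring "module_vec TYPE('k) N" by (rule vec_vs)
  have "\<chi> (v + w) = \<chi> v \<oplus>\<^bsub>V\<^esub> \<chi> w" if "v \<in> carrier_vec N" "w \<in> carrier_vec N" for v w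
    using that by (intro coord_eqI) (auto simp: coord_add coord_inv inv_closed)
  moreover have "\<chi> (c \<cdot>\<^sub>v v) = c \<odot>\<^bsub>V\<^esub> \<chi> v" if "v \<in> carrier_vec N" for c v
    using that by (intro coord_eqI) (auto simp: coord_smult coord_inv inv_closed smult_closed)
  ultimately show ?thesis
    by unfold_locales (auto simp: module_hom_def inv_closed module_vec_simps)
qed

lemma ordered_basis_iff:
  "ordered_basis V bs \<longleftrightarrow>
    set bs \<subseteq> carrier V \<and> length bs = N \<and> det (mat_of_cols N (map \<psi> bs)) \<noteq> 0"
proof -
  interpret V: vectorspace class_ring V by (rule vectorspace)
  interpret W: vec_space "TYPE('k)" N .
  have inj: "inj_on \<psi> (carrier V)" and surj: "\<psi> ` carrier V = carrier W.V"
    using bij by (auto simp: bij_betw_def)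
  have inj': "inj_on \<chi> (carrier W.V)"
    by (rule inj_on_inverseI[of _ \<psi>]) (simp add: coord_inv)
  have surj': "\<chi> ` carrier W.V = carrier V"
    using inv_coord inv_closed coord_closed by force
  have fd: "V.fin_dim"
    by (rule linear_map.surj_fin_dim[OF linear_map_inv W.fin_dim surj'])
  have "ordered_basis V bs \<longleftrightarrow> set bs \<subseteq> carrier V \<and> ordered_basis W.V (map \<psi> bs)"
  proof (cases "set bs \<subseteq> carrier V")
    case sub: True
    have "\<chi> ` \<psi> ` set bs = set bs"
      using sub inv_coord by force
    then have "V.basis (set bs) \<longleftrightarrow> W.basis (\<psi> ` set bs)"
      using linear_map.linear_inj_image_is_basis[OF linear_map_coord inj surj _ fd, of "set bs"]
        linear_map.linear_inj_image_is_basis[OF linear_map_inv inj' surj' _ W.fin_dim, of "\<psi> ` set bs"]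
      by auto
    moreover have "inj_on \<psi> (set bs)"
      by (rule inj_on_subset[OF inj sub])
    ultimately show ?thesis
      using sub by (simp add: ordered_basis_def distinct_map vectorspace W.vectorspace_axioms)
  qed (auto simp: ordered_basis_def V.basis_def)
  also have "\<dots> \<longleftrightarrow> set bs \<subseteq> carrier V \<and> length bs = N \<and> det (mat_of_cols N (map \<psi> bs)) \<noteq> 0"
    using coord_closed by (auto simp: ordered_basis_vec_iff)
  finally show ?thesis .
qed

lemma is_matrix_of_iff:
  assumes bs: "set bs \<subseteq> carrier V" "length bs = N"
    and T: "\<And>x. x \<in> carrier V \<Longrightarrow> T x \<in> carrier V"
    and K: "K \<in> carrier_mat N N" "\<And>x. x \<in> carrier V \<Longrightarrow> \<psi> (T x) = K *\<^sub>v \<psi> x"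
  shows "is_matrix_of V bs T M \<longleftrightarrow> M \<in> carrier_mat N N \<and>
    K * mat_of_cols N (map \<psi> bs) = mat_of_cols N (map \<psi> bs) * M"
proof (cases "M \<in> carrier_mat N N")
  case M: True
  interpret V: vectorspace class_ring V by (rule vectorspace)
  let ?P = "mat_of_cols N (map \<psi> bs)"
  have P: "?P \<in> carrier_mat N N" using bs by auto
  have bsc: "bs ! c \<in> carrier V" if "c < N" for c
    using bs that by auto
  have colP: "col ?P c = \<psi> (bs ! c)" if "c < N" for c
    using bs that bsc[OF that] coord_closed by (subst col_mat_of_cols) auto
  have "T (bs ! c) = (\<Oplus>\<^bsub>V\<^esub>r\<in>{..<N}. M $$ (r, c) \<odot>\<^bsub>V\<^esub> (bs ! r)) \<longleftrightarrow> col (K * ?P) c = col (?P * M) c"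
    (is "?x = ?y \<longleftrightarrow> _") if c: "c < N" for c
  proof -
    have y: "?y \<in> carrier V"
      using bsc by (intro V.finsum_closed) (auto intro: smult_closed)
    have "\<psi> ?x = col (K * ?P) c"
      using c by (simp add: K(2)[OF bsc[OF c]] col_mult2[OF K(1) P c] colP)
    moreover have "\<psi> ?y = col (?P * M) c"
    proof (rule eq_vecI)
      fix i assume "i < dim_vec (col (?P * M) c)"
      then have i: "i < N" using P by simp
      have "\<psi> ?y $ i = (\<Sum>r<N. M $$ (r, c) * \<psi> (bs ! r) $ i)"
        using i bsc by (subst coord_finsum)
          (auto simp: coord_smult smult_closed carrier_vecD[OF coord_closed])
      also have "\<dots> = col (?P * M) c $ i"
        using i c M P bs by (auto simp: scalar_prod_def mat_of_cols_index atLeast0LessThan mult.commute intro!: sum.cong)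
      finally show "\<psi> ?y $ i = col (?P * M) c $ i" .
    qed (use coord_closed[OF y] P in auto)
    ultimately show ?thesis
      using coord_eqI[of ?x ?y] y T[OF bsc[OF c]] by metis
  qed
  then have "is_matrix_of V bs T M \<longleftrightarrow> (\<forall>c<N. col (K * ?P) c = col (?P * M) c)"
    using M bs by (simp add: is_matrix_of_def)
  also have "\<dots> \<longleftrightarrow> K * ?P = ?P * M"
  proof
    assume "\<forall>c<N. col (K * ?P) c = col (?P * M) c"
    then show "K * ?P = ?P * M"
      using K(1) P M by (intro mat_col_eqI) auto
  qed simp
  finally show ?thesis using M by simp
qed (use bs in \<open>auto simp: is_matrix_of_def\<close>)

text \<open>In coordinates a basis is an invertible matrix \<open>P\<close>, and \<open>T\<close> has matrix \<open>J\<close> in this basis iff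
  \<open>K P = P J\<close>; so the Jordan forms of the operator \<open>T\<close> are those of the matrix \<open>K\<close>.\<close>

lemma operator_jordan_nf_iff:
  assumes T: "\<And>x. x \<in> carrier V \<Longrightarrow> T x \<in> carrier V"
    and K: "K \<in> carrier_mat N N" "\<And>x. x \<in> carrier V \<Longrightarrow> \<psi> (T x) = K *\<^sub>v \<psi> x"
  shows "operator_jordan_nf V T n_as \<longleftrightarrow> jordan_nf K n_as"
proof -
  let ?J = "jordan_matrix n_as"
  have "(\<exists>bs. ordered_basis V bs \<and> is_matrix_of V bs T ?J) \<longleftrightarrow> similar_mat K ?J"
  proof
    assume "\<exists>bs. ordered_basis V bs \<and> is_matrix_of V bs T ?J"
    then obtain bs where bs: "set bs \<subseteq> carrier V" "length bs = N"
      and det: "det (mat_of_cols N (map \<psi> bs)) \<noteq> 0" and mat: "is_matrix_of V bs T ?J"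
      by (auto simp: ordered_basis_iff)
    define P where "P = mat_of_cols N (map \<psi> bs)"
    have P: "P \<in> carrier_mat N N" using bs by (auto simp: P_def)
    have J: "?J \<in> carrier_mat N N" and eq: "K * P = P * ?J"
      using mat is_matrix_of_iff[OF bs T K, of ?J] by (auto simp: P_def)
    obtain Q where Q: "Q \<in> carrier_mat N N" "P * Q = 1\<^sub>m N" "Q * P = 1\<^sub>m N"
      using det_non_zero_imp_unit[OF P, of "()"] det unfolding P_def[symmetric]
      by (auto simp: Units_def ring_mat_simps)
    have "P * ?J * Q = K * (P * Q)"
      unfolding eq[symmetric] using K P Q by (intro assoc_mult_mat) auto
    then have "K = P * ?J * Q" using K Q by simp
    then show "similar_mat K ?J"
      using K J P Q by (intro similar_matI[of _ _ P Q N]) auto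
  next
    assume "similar_mat K ?J"
    then obtain P Q where w: "similar_mat_wit K ?J P Q" by (auto simp: similar_mat_def)
    note w = similar_mat_witD2[OF K(1) w]
    define bs where "bs = map \<chi> (cols P)"
    have colsP: "set (cols P) \<subseteq> carrier_vec N" using w(6) cols_dim[of P] by auto
    have bs: "set bs \<subseteq> carrier V" "length bs = N"
      using colsP w(6) inv_closed by (auto simp: bs_def)
    have "map \<psi> bs = cols P"
      using colsP coord_inv by (auto simp: bs_def intro!: map_idI)
    then have P: "mat_of_cols N (map \<psi> bs) = P"
      using w(6) mat_of_cols_cols[of P] by auto
    have "det P * det Q = 1"
      using det_mult[OF w(6,7)] w(1) by simp
    then have "det P \<noteq> 0" by auto
    then have "ordered_basis V bs" using bs P by (simp add: ordered_basis_iff)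
    moreover have "P * ?J * Q * P = P * ?J * (Q * P)"
      by (rule assoc_mult_mat[OF mult_carrier_mat[OF w(6,5)] w(7,6)])
    then have "K * P = P * ?J"
      using w(2) right_mult_one_mat[OF mult_carrier_mat[OF w(6,5)]] by (simp add: w(3)[symmetric])
    then have "is_matrix_of V bs T ?J"
      using is_matrix_of_iff[OF bs T K, of ?J] P w(5) by auto
    ultimately show "\<exists>bs. ordered_basis V bs \<and> is_matrix_of V bs T ?J" by blast
  qed
  then show ?thesis
    by (auto simp: operator_jordan_nf_def jordan_nf_def)
qed

end

section \<open>Action of polynomials on vectors through a matrix\<close>

text \<open>Evaluation of \<open>p\<close> at \<open>M\<close>, applied to \<open>v\<close>, by the Horner scheme.\<close>

definition poly_act :: "'a :: comm_ring_1 mat \<Rightarrow> 'a poly \<Rightarrow> 'a vec \<Rightarrow> 'a vec" where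
  "poly_act M p v = foldr (\<lambda>a w. a \<cdot>\<^sub>v v + M *\<^sub>v w) (coeffs p) (0\<^sub>v (dim_row M))"

context
  fixes M :: "'a :: field mat" and N :: nat and v :: "'a vec"
  assumes M: "M \<in> carrier_mat N N" and v: "v \<in> carrier_vec N"
begin

lemma poly_act_0: "poly_act M 0 v = 0\<^sub>v N"
  using M by (simp add: poly_act_def)

lemma poly_act_pCons: "poly_act M (pCons a p) v = a \<cdot>\<^sub>v v + M *\<^sub>v poly_act M p v"
proof (cases "a = 0 \<and> p = 0")
  case True
  then show ?thesis
    using M v by (auto simp: poly_act_def intro!: eq_vecI)
qed (auto simp: poly_act_def cCons_def)

lemma poly_act_closed: "poly_act M p v \<in> carrier_vec N"
  using M v by (induction p) (auto simp: poly_act_0 poly_act_pCons)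

lemma poly_act_add: "poly_act M (p + q) v = poly_act M p v + poly_act M q v"
proof (induction p q rule: poly_induct2)
  case (pCons a p b q)
  let ?p = "poly_act M p v" and ?q = "poly_act M q v"
  have "poly_act M (pCons a p + pCons b q) v = (a \<cdot>\<^sub>v v + b \<cdot>\<^sub>v v) + (M *\<^sub>v ?p + M *\<^sub>v ?q)"
    using pCons M v poly_act_closed
    by (simp add: poly_act_pCons add_smult_distrib_vec mult_add_distrib_mat_vec[OF M])
  also have "\<dots> = (a \<cdot>\<^sub>v v + M *\<^sub>v ?p) + (b \<cdot>\<^sub>v v + M *\<^sub>v ?q)"
    using M v by (intro eq_vecI) auto
  finally show ?case by (simp add: poly_act_pCons)
qed (simp add: poly_act_0)

lemma poly_act_smult: "poly_act M (Polynomial.smult c p) v = c \<cdot>\<^sub>v poly_act M p v"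
proof (induction p)
  case (pCons a p)
  have "c \<cdot>\<^sub>v (a \<cdot>\<^sub>v v + M *\<^sub>v poly_act M p v) =
      c \<cdot>\<^sub>v (a \<cdot>\<^sub>v v) + c \<cdot>\<^sub>v (M *\<^sub>v poly_act M p v)"
    using M v poly_act_closed by (intro smult_add_distrib_vec) auto
  then show ?case
    using pCons M poly_act_closed
    by (simp add: poly_act_pCons smult_smult_assoc mult_mat_vec[OF M])
qed (auto simp: poly_act_0 intro!: eq_vecI)

lemma poly_act_const: "poly_act M [:c:] v = c \<cdot>\<^sub>v v"
  using M v by (auto simp: poly_act_pCons poly_act_0 intro!: eq_vecI)

lemma poly_act_x: "poly_act M (pCons 0 p) v = M *\<^sub>v poly_act M p v"
  using M v by (auto simp: poly_act_pCons intro!: eq_vecI)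

end

section \<open>The quotient lattice at a point of the slice\<close>

lemma poly_shift_Suc: "pCons (poly.coeff p m) (poly_shift (Suc m) p) = poly_shift m p"
  by (rule poly_eqI) (auto simp: coeff_pCons coeff_poly_shift split: nat.split)

lemma const_poly_sum: "[:\<Sum>i\<in>I. f i:] = (\<Sum>i\<in>I. [:f i:])"
  by (rule poly_eqI) (simp add: coeff_sum coeff_pCons split: nat.split)

lemma poly_shift_mult_eq_sum:
  assumes "\<And>k. m \<le> k \<Longrightarrow> poly.coeff p k = 0"
  shows "poly_shift m (p * q) = (\<Sum>k<m. [:poly.coeff p k:] * poly_shift (m - k) q)"
proof (rule poly_eqI)
  fix l
  have "poly.coeff (poly_shift m (p * q)) l = (\<Sum>k\<le>l + m. poly.coeff p k * poly.coeff q (l + m - k))"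
    by (simp add: coeff_poly_shift coeff_mult)
  also have "\<dots> = (\<Sum>k<m. poly.coeff p k * poly.coeff q (l + m - k))"
    by (rule sum.mono_neutral_right) (auto simp: assms)
  also have "\<dots> = poly.coeff (\<Sum>k<m. [:poly.coeff p k:] * poly_shift (m - k) q) l"
    by (auto simp: coeff_sum coeff_poly_shift intro!: sum.cong)
  finally show "poly.coeff (poly_shift m (p * q)) l =
      poly.coeff (\<Sum>k<m. [:poly.coeff p k:] * poly_shift (m - k) q) l" .
qed

lemma mult_mat_unit_vec:
  fixes M :: "'a :: semiring_1 mat"
  assumes "M \<in> carrier_mat N N" "c < N"
  shows "M *\<^sub>v unit_vec N c = col M c"
proof (rule eq_vecI)
  fix i assume "i < dim_vec (col M c)"
  then show "(M *\<^sub>v unit_vec N c) $ i = col M c $ i"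
    using assms scalar_prod_right_unit[of c N "row M i"] by simp
qed (use assms in auto)

lemma v_list_eq_map: "v_list mu A = map (\<lambda>(i, k). v_vec mu A i k) (block_index mu)"
  by (simp add: v_list_def block_index_def map_concat comp_def)

lemma v_vec_carrier: "v_vec mu A i k \<in> carrier_vec (length mu)"
proof (induction k)
  case (Suc k)
  have "finsum_vec TYPE(complex poly) (length mu)
      (\<lambda>j. [:b_coeff mu A j i (mu ! i - Suc k):] \<cdot>\<^sub>v v_vec mu A j 0) {..<i} \<in> carrier_vec (length mu)"
    by (rule finsum_vec_closed) auto
  then show ?case using Suc by simp
qed simp

lemma v_vec_Suc_index:
  assumes "i < length mu" "s < length mu"
  shows "v_vec mu A i (Suc k) $ s = [:0, 1:] * v_vec mu A i k $ s -
     (if s < i then [:b_coeff mu A s i (mu ! i - Suc k):] else 0)"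
proof -
  let ?f = "\<lambda>j. [:b_coeff mu A j i (mu ! i - Suc k):] \<cdot>\<^sub>v v_vec mu A j 0"
  have f: "?f \<in> {..<i} \<rightarrow> carrier_vec (length mu)" by auto
  have "finsum_vec TYPE(complex poly) (length mu) ?f {..<i} $ s = (\<Sum>j<i. ?f j $ s)"
    by (rule index_finsum_vec[OF _ assms(2) f]) simp
  also have "\<dots> = (\<Sum>j<i. if j = s then [:b_coeff mu A s i (mu ! i - Suc k):] else 0)"
    using assms by (intro sum.cong) auto
  finally have "finsum_vec TYPE(complex poly) (length mu) ?f {..<i} $ s =
      (if s < i then [:b_coeff mu A s i (mu ! i - Suc k):] else 0)"
    by simp
  moreover have "finsum_vec TYPE(complex poly) (length mu) ?f {..<i} \<in> carrier_vec (length mu)"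
    by (rule finsum_vec_closed[OF f])
  ultimately show ?thesis
    using assms v_vec_carrier[of mu A i k] by simp
qed

locale slice_point =
  fixes mu :: "nat list" and b :: "nat \<times> nat \<times> nat \<Rightarrow> complex"
  assumes pos: "i < length mu \<Longrightarrow> 1 \<le> mu ! i" and b: "b \<in> param_space mu"
begin

abbreviation n :: nat where "n \<equiv> length mu"
abbreviation N :: nat where "N \<equiv> sum_list mu"
abbreviation A :: "complex poly mat" where "A \<equiv> slice_mat mu b"
abbreviation M :: "complex mat" where "M \<equiv> comp_mat mu b"
abbreviation B :: "nat \<Rightarrow> nat \<Rightarrow> complex poly" where "B \<equiv> bpoly mu b"
abbreviation v :: "nat \<Rightarrow> complex poly vec" where "v r \<equiv> v_list mu A ! r"

lemma A_carrier: "A \<in> carrier_mat n n"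
  by (simp add: slice_mat_def)

lemma M_carrier: "M \<in> carrier_mat N N"
  by (rule comp_mat_carrier)

lemma length_v_list: "length (v_list mu A) = N"
  by (simp add: v_list_eq_map length_block_index)

lemma v_offset:
  assumes "i < n" "k < mu ! i"
  shows "v (offset mu i + k) = v_vec mu A i k"
  using block_index_offset[OF assms] by (simp add: v_list_eq_map length_block_index)

lemma offset_less: "i < n \<Longrightarrow> offset mu i < N"
  using block_index_offset(1)[of i mu 0] pos[of i] by simp

lemma v_carrier: "r < N \<Longrightarrow> v r \<in> carrier_vec n"
  by (erule block_index_cases) (simp add: v_offset v_vec_carrier)

lemma coeff_B: "i < n \<Longrightarrow> j < n \<Longrightarrow> poly.coeff (B i j) l = b (i, j, l)"
  by (rule coeff_bpoly_param[OF b])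

text \<open>From \<open>x\<^sup>k e\<^sub>i\<close> the polynomial parts of \<open>x\<^sup>k b\<^sub>s\<^sub>,\<^sub>i / x^\<mu>\<^sub>i\<close> for \<open>s < i\<close> are subtracted. The
  value \<open>k = \<mu>\<^sub>i\<close> is admitted although \<open>v\<^sub>i\<^sub>,\<^sub>k\<close> is then not a basis vector: it occurs when the last
  vector of a block is multiplied by \<open>x\<close>.\<close>

lemma v_vec_index:
  assumes i: "i < n" and s: "s < n" and k: "k \<le> mu ! i"
  shows "v_vec mu A i k $ s =
    (if s = i then monom 1 k else if s < i then - poly_shift (mu ! i - k) (B s i) else 0)"
  using k
proof (induction k)
  case 0
  have "poly_shift (mu ! i) (B s i) = 0" if "s < i"
    by (rule poly_eqI) (use that in \<open>simp add: coeff_poly_shift coeff_bpoly\<close>)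
  then show ?case
    using i s by (auto simp: one_pCons monom_0)
next
  case (Suc k)
  define m where "m = mu ! i - Suc k"
  have m: "mu ! i - k = Suc m" using Suc.prems by (simp add: m_def)
  have "- (pCons 0 (poly_shift (Suc m) (B s i))) - [:b (s, i, m):] = - poly_shift m (B s i)"
    unfolding poly_shift_Suc[of "B s i" m, symmetric] by (simp add: coeff_B[OF s i])
  then show ?case
    using Suc unfolding v_vec_Suc_index[OF i s]
    by (auto simp: m m_def[symmetric] monom_Suc b_coeff_slice_mat[OF b])
qed

text \<open>Multiplication by \<open>x\<close> acts on the \<open>v\<close> through \<open>M\<close> up to columns of \<open>A\<close>. At the last vector of
  block \<open>i\<close>, the linear combination of the \<open>v\<^sub>j\<^sub>,\<^sub>k\<close> with \<open>j \<ge> i\<close> and coefficients \<open>b\<^sub>j\<^sub>,\<^sub>i\<close> has as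
  entry \<open>s\<close> the term \<open>b\<^sub>s\<^sub>,\<^sub>i\<close>, if \<open>s \<ge> i\<close>, and minus the polynomial parts of \<open>b\<^sub>j\<^sub>,\<^sub>i b\<^sub>s\<^sub>,\<^sub>j / x^\<mu>\<^sub>j\<close>: the
  quadratic terms in the slice matrix, and with them those in the recursion for \<open>b\<close>, come from the
  corrections in the vectors \<open>v\<close>.\<close>

lemma x_times_v:
  assumes i: "i < n" and m: "m < mu ! i" and s: "s < n"
  shows "[:0, 1:] * v (offset mu i + m) $ s -
      (\<Sum>r<N. [:M $$ (r, offset mu i + m):] * v r $ s) =
    (if m = mu ! i - 1 then A $$ (s, i) else 0)"
proof -
  \<comment> \<open>the contribution of block \<open>j\<close>\<close>
  define S where "S j = (\<Sum>k<mu ! j. [:comp_entry mu b (j, k) (i, m):] * v_vec mu A j k $ s)" for j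
  have "(\<Sum>r<N. [:M $$ (r, offset mu i + m):] * v r $ s) = (\<Sum>j<n. S j)"
    unfolding sum_block_index S_def
    by (intro sum.cong) (auto simp: comp_mat_index[OF _ _ i m] v_offset)
  also have "\<dots> = (\<Sum>j<i. S j) + (\<Sum>j\<in>{i..<n}. S j)"
    using i by (simp add: lessThan_atLeast0 sum.atLeastLessThan_concat)
  also have "(\<Sum>j<i. S j) = (\<Sum>j<i. if j = s then [:b (s, i, mu ! i - Suc m):] else 0)"
  proof (rule sum.cong)
    fix j assume j: "j \<in> {..<i}"
    then have jn: "j < n" using i by simp
    have "S j = (\<Sum>k<mu ! j. if k = 0 then [:b (j, i, mu ! i - Suc m):] * v_vec mu A j 0 $ s else 0)"
      unfolding S_def using j by (intro sum.cong) (auto simp: comp_entry_def)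
    also have "\<dots> = [:b (j, i, mu ! i - Suc m):] * v_vec mu A j 0 $ s"
      using pos[OF jn] by (simp add: sum.delta)
    finally show "S j = (if j = s then [:b (s, i, mu ! i - Suc m):] else 0)"
      using jn s by auto
  qed simp
  also have "\<dots> = (if s < i then [:b (s, i, mu ! i - Suc m):] else 0)"
    by simp
  finally have sum_eq: "(\<Sum>r<N. [:M $$ (r, offset mu i + m):] * v r $ s) =
      (if s < i then [:b (s, i, mu ! i - Suc m):] else 0) + (\<Sum>j\<in>{i..<n}. S j)" .
  have "[:0, 1:] * v (offset mu i + m) $ s - (if s < i then [:b (s, i, mu ! i - Suc m):] else 0) =
      v_vec mu A i (Suc m) $ s"
    unfolding v_offset[OF i m] v_vec_Suc_index[OF i s] b_coeff_slice_mat[OF b refl] ..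
  then have eq: "[:0, 1:] * v (offset mu i + m) $ s -
      (\<Sum>r<N. [:M $$ (r, offset mu i + m):] * v r $ s) = v_vec mu A i (Suc m) $ s - (\<Sum>j\<in>{i..<n}. S j)"
    unfolding sum_eq by (simp add: algebra_simps)
  show ?thesis
  proof (cases "m = mu ! i - 1")
    case False
    have Sm: "Suc m < mu ! i" using False m by linarith
    have "S j = (if j = i then v_vec mu A i (Suc m) $ s else 0)" if "j \<in> {i..<n}" for j
    proof -
      have "S j = (\<Sum>k<mu ! j. if k = Suc m then (if j = i then v_vec mu A i (Suc m) $ s else 0) else 0)"
        unfolding S_def using that False by (intro sum.cong) (auto simp: comp_entry_def)
      also have "\<dots> = (if j = i then v_vec mu A i (Suc m) $ s else 0)"
        using Sm by (auto simp: sum.delta)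
      finally show ?thesis .
    qed
    then have "(\<Sum>j\<in>{i..<n}. S j) = (\<Sum>j\<in>{i..<n}. if j = i then v_vec mu A i (Suc m) $ s else 0)"
      by (rule sum.cong[OF refl])
    then show ?thesis
      unfolding eq using False i by simp
  next
    case True
    have Sm: "Suc m = mu ! i" using True pos[OF i] by simp
    have S: "S j = (if j = s then B j i else 0) -
        (if j \<in> {max i (Suc s)..<n} then poly_shift (mu ! j) (B j i * B s j) else 0)"
      if j: "j \<in> {i..<n}" for j
    proof -
      have jn: "j < n" and mx: "max j i = j" using j by auto
      have Sj: "S j = (\<Sum>k<mu ! j. [:poly.coeff (B j i) k:] * v_vec mu A j k $ s)"
        unfolding S_def using j True by (intro sum.cong) (auto simp: comp_entry_def coeff_B[OF jn i])
      consider "j = s" | "s < j" | "j < s" by linarith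
      then show ?thesis
      proof cases
        case 1
        have "S j = (\<Sum>k<mu ! j. monom (poly.coeff (B j i) k) k)"
          unfolding Sj using 1 jn s by (intro sum.cong) (auto simp: v_vec_index smult_monom)
        also have "\<dots> = B j i"
          by (rule poly_eqI) (simp add: coeff_sum coeff_bpoly mx)
        finally show ?thesis using 1 by simp
      next
        case 2
        have "S j = - (\<Sum>k<mu ! j. [:poly.coeff (B j i) k:] * poly_shift (mu ! j - k) (B s j))"
          unfolding Sj sum_negf[symmetric] using 2 jn s by (intro sum.cong) (auto simp: v_vec_index)
        also have "\<dots> = - poly_shift (mu ! j) (B j i * B s j)"
          by (subst poly_shift_mult_eq_sum) (auto simp: coeff_bpoly mx)
        finally show ?thesis using 2 j by simp
      next
        case 3
        have "S j = 0"
          unfolding Sj using 3 jn s by (intro sum.neutral) (auto simp: v_vec_index)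
        then show ?thesis using 3 by simp
      qed
    qed
    have "(\<Sum>j\<in>{i..<n}. S j) = (\<Sum>j\<in>{i..<n}. if j = s then B j i else 0) -
        (\<Sum>j\<in>{i..<n}. if j \<in> {max i (Suc s)..<n} then poly_shift (mu ! j) (B j i * B s j) else 0)"
      by (simp only: S sum_subtractf cong: sum.cong)
    also have "(\<Sum>j\<in>{i..<n}. if j \<in> {max i (Suc s)..<n} then poly_shift (mu ! j) (B j i * B s j) else 0) =
        (\<Sum>j\<in>{max i (Suc s)..<n}. poly_shift (mu ! j) (B j i * B s j))"
      by (subst sum.inter_restrict[symmetric]) (auto intro!: sum.cong)
    finally have "(\<Sum>j\<in>{i..<n}. S j) = (if i \<le> s then B s i else 0) -
        (\<Sum>j\<in>{max i (Suc s)..<n}. poly_shift (mu ! j) (B j i * B s j))"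
      using s by simp
    then have "v_vec mu A i (Suc m) $ s - (\<Sum>j\<in>{i..<n}. S j) = slice_entry mu b s i"
      unfolding slice_entry_def Sm using v_vec_index[OF i s, of "mu ! i"]
      by (auto simp: poly_shift_id)
    then show ?thesis
      unfolding eq using True i s by (simp add: slice_mat_def)
  qed
qed

end

context slice_point
begin

section \<open>Coordinates on the quotient\<close>

lemma smult_closed_vec: "f \<in> carrier_vec m \<Longrightarrow> c \<cdot>\<^sub>v f \<in> carrier_vec m"
  by simp

text \<open>Let \<open>x\<close> act on \<open>\<complex>\<^sup>N\<close> by \<open>M\<close>. Then \<open>\<phi>\<close> is the \<open>\<complex>[x]\<close>-linear map that sends \<open>e\<^sub>i\<close> to the
  unit vector at the position of \<open>v\<^sub>i\<^sub>,\<^sub>0\<close>. It turns out to send every \<open>v\<^sub>i\<^sub>,\<^sub>k\<close> to the unit vector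
  at its position, and to have the lattice as its kernel.\<close>

definition \<phi> :: "complex poly vec \<Rightarrow> complex vec" where
  "\<phi> f = vec N (\<lambda>t. \<Sum>i<n. poly_act M (f $ i) (unit_vec N (offset mu i)) $ t)"

lemma phi_closed: "\<phi> f \<in> carrier_vec N"
  by (simp add: \<phi>_def)

lemma act_closed: "poly_act M p (unit_vec N k) \<in> carrier_vec N"
  by (rule poly_act_closed[OF M_carrier unit_vec_carrier])

lemma phi_add:
  assumes "f \<in> carrier_vec n" "g \<in> carrier_vec n"
  shows "\<phi> (f + g) = \<phi> f + \<phi> g"
  using assms
  by (intro eq_vecI)
     (auto simp: \<phi>_def poly_act_add[OF M_carrier unit_vec_carrier] sum.distrib carrier_vecD[OF act_closed])

lemma phi_const:
  assumes "f \<in> carrier_vec n"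
  shows "\<phi> ([:c:] \<cdot>\<^sub>v f) = c \<cdot>\<^sub>v \<phi> f"
  using assms
  by (intro eq_vecI)
     (auto simp: \<phi>_def poly_act_smult[OF M_carrier unit_vec_carrier] sum_distrib_left carrier_vecD[OF act_closed])

lemma phi_x:
  assumes f: "f \<in> carrier_vec n"
  shows "\<phi> ([:0, 1:] \<cdot>\<^sub>v f) = M *\<^sub>v \<phi> f"
proof (rule eq_vecI)
  fix t assume "t < dim_vec (M *\<^sub>v \<phi> f)"
  then have t: "t < N" using M_carrier by simp
  let ?a = "\<lambda>i. poly_act M (f $ i) (unit_vec N (offset mu i))"
  have "\<phi> ([:0, 1:] \<cdot>\<^sub>v f) $ t = (\<Sum>i<n. (M *\<^sub>v ?a i) $ t)"
    using t f by (simp add: \<phi>_def poly_act_x[OF M_carrier unit_vec_carrier])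
  also have "\<dots> = (\<Sum>i<n. \<Sum>c<N. M $$ (t, c) * ?a i $ c)"
    using t M_carrier carrier_vecD[OF act_closed]
    by (intro sum.cong) (auto simp: scalar_prod_def atLeast0LessThan)
  also have "\<dots> = (\<Sum>c<N. M $$ (t, c) * \<phi> f $ c)"
    by (subst sum.swap) (simp add: \<phi>_def sum_distrib_left)
  also have "\<dots> = (M *\<^sub>v \<phi> f) $ t"
    using t M_carrier phi_closed[of f] by (auto simp: scalar_prod_def atLeast0LessThan)
  finally show "\<phi> ([:0, 1:] \<cdot>\<^sub>v f) $ t = (M *\<^sub>v \<phi> f) $ t" .
qed (use M_carrier in \<open>simp add: \<phi>_def\<close>)

lemma phi_unit:
  assumes i: "i < n"
  shows "\<phi> (unit_vec n i) = unit_vec N (offset mu i)"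
proof (rule eq_vecI)
  fix t assume "t < dim_vec (unit_vec N (offset mu i))"
  then have t: "t < N" by simp
  have "\<phi> (unit_vec n i) $ t = (\<Sum>j<n. if j = i then unit_vec N (offset mu i) $ t else 0)"
  proof -
    have "poly_act M (unit_vec n i $ j) (unit_vec N (offset mu j)) $ t =
        (if j = i then unit_vec N (offset mu i) $ t else 0)" if "j < n" for j
      using that t i poly_act_const[OF M_carrier unit_vec_carrier, of 1]
      by (auto simp: poly_act_0[OF M_carrier] one_pCons)
    then show ?thesis using t by (simp add: \<phi>_def)
  qed
  then show "\<phi> (unit_vec n i) $ t = unit_vec N (offset mu i) $ t"
    using i by simp
qed (simp add: \<phi>_def)

lemma phi_diff:
  assumes f: "f \<in> carrier_vec n" and g: "g \<in> carrier_vec n"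
  shows "\<phi> (f - g) = \<phi> f - \<phi> g"
proof -
  have "f - g = f + [:- 1:] \<cdot>\<^sub>v g"
    using f g by (auto intro!: eq_vecI)
  then have "\<phi> (f - g) = \<phi> f + (- 1) \<cdot>\<^sub>v \<phi> g"
    using f g by (simp only: phi_add[OF f smult_closed_vec[OF g]] phi_const[OF g])
  also have "\<dots> = \<phi> f - \<phi> g"
    using phi_closed by (auto intro!: eq_vecI)
  finally show ?thesis .
qed

lemma phi_zero: "\<phi> (0\<^sub>v n) = 0\<^sub>v N"
  by (auto simp: \<phi>_def poly_act_0[OF M_carrier] intro!: eq_vecI)

lemma phi_sum:
  assumes "finite S" "\<And>r. r \<in> S \<Longrightarrow> g r \<in> carrier_vec n"
  shows "\<phi> (vec n (\<lambda>s. \<Sum>r\<in>S. g r $ s)) = vec N (\<lambda>t. \<Sum>r\<in>S. \<phi> (g r) $ t)"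
  using assms
proof (induction S rule: finite_induct)
  case empty
  have "vec n (\<lambda>s. 0) = (0\<^sub>v n :: complex poly vec)" "vec N (\<lambda>s. 0) = (0\<^sub>v N :: complex vec)"
    by auto
  then show ?case by (simp add: phi_zero)
next
  case (insert x S)
  have x: "g x \<in> carrier_vec n" using insert by simp
  have "vec n (\<lambda>s. \<Sum>r\<in>insert x S. g r $ s) = g x + vec n (\<lambda>s. \<Sum>r\<in>S. g r $ s)"
    using insert x by (intro eq_vecI) auto
  then have "\<phi> (vec n (\<lambda>s. \<Sum>r\<in>insert x S. g r $ s)) = \<phi> (g x) + vec N (\<lambda>t. \<Sum>r\<in>S. \<phi> (g r) $ t)"
    using insert x by (simp add: phi_add)
  also have "\<dots> = vec N (\<lambda>t. \<Sum>r\<in>insert x S. \<phi> (g r) $ t)"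
    using insert phi_closed[of "g x"] by (intro eq_vecI) auto
  finally show ?case .
qed

text \<open>The recursion for \<open>v\<^sub>i\<^sub>,\<^sub>k\<close> subtracts from \<open>x v\<^sub>i\<^sub>,\<^sub>k\<^sub>-\<^sub>1\<close> precisely what \<open>M\<close> adds to the next unit
  vector.\<close>

lemma phi_v_vec:
  assumes i: "i < n"
  shows "k < mu ! i \<Longrightarrow> \<phi> (v_vec mu A i k) = unit_vec N (offset mu i + k)"
proof (induction k)
  case 0
  then show ?case using phi_unit[OF i] by simp
next
  case (Suc k)
  let ?c = "offset mu i + k" and ?l = "mu ! i - Suc k"
  have k: "k < mu ! i" using Suc.prems by simp
  have c: "?c < N" "Suc ?c < N"
    using block_index_offset(1)[OF i k] block_index_offset(1)[OF i Suc.prems] by simp_all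
  let ?w = "vec n (\<lambda>s. \<Sum>j<i. ([:b (j, i, ?l):] \<cdot>\<^sub>v unit_vec n j) $ s)"
  have "v_vec mu A i (Suc k) = [:0, 1:] \<cdot>\<^sub>v v_vec mu A i k - ?w"
  proof (rule eq_vecI)
    fix s assume "s < dim_vec ([:0, 1:] \<cdot>\<^sub>v v_vec mu A i k - ?w)"
    then have s: "s < n" by simp
    have "(\<Sum>j<i. ([:b (j, i, ?l):] \<cdot>\<^sub>v unit_vec n j) $ s) = (\<Sum>j<i. if j = s then [:b (s, i, ?l):] else 0)"
      using s i by (intro sum.cong) auto
    then show "v_vec mu A i (Suc k) $ s = ([:0, 1:] \<cdot>\<^sub>v v_vec mu A i k - ?w) $ s"
      using s carrier_vecD[OF v_vec_carrier, of mu A i k]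
      unfolding v_vec_Suc_index[OF i s] b_coeff_slice_mat[OF b refl] by simp
  qed (use carrier_vecD[OF v_vec_carrier, of mu A i "Suc k"] in simp)
  then have "\<phi> (v_vec mu A i (Suc k)) = M *\<^sub>v unit_vec N ?c - \<phi> ?w"
    using Suc.IH[OF k] by (simp only: phi_diff[OF smult_closed_vec[OF v_vec_carrier] vec_carrier]
        phi_x[OF v_vec_carrier])
  also have "\<phi> ?w = vec N (\<lambda>t. \<Sum>j<i. (b (j, i, ?l) \<cdot>\<^sub>v unit_vec N (offset mu j)) $ t)"
    using i by (subst phi_sum) (auto simp: phi_const phi_unit intro!: eq_vecI sum.cong)
  also have "M *\<^sub>v unit_vec N ?c - \<dots> = unit_vec N (offset mu i + Suc k)"
  proof (rule eq_vecI)
    fix t assume "t < dim_vec (unit_vec N (offset mu i + Suc k))"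
    then have t: "t < N" by simp
    then obtain j m where jm: "j < n" "m < mu ! j" "t = offset mu j + m"
      by (rule block_index_cases)
    have "(\<Sum>j'<i. (b (j', i, ?l) \<cdot>\<^sub>v unit_vec N (offset mu j')) $ t) =
        (\<Sum>j'<i. if j' = j then (if m = 0 then b (j, i, ?l) else 0) else 0)"
    proof (rule sum.cong)
      fix j' assume "j' \<in> {..<i}"
      then have j': "j' < n" using i by simp
      have "t = offset mu j' \<longleftrightarrow> j = j' \<and> m = 0"
        using offset_inject[OF jm(1,2) j', of 0] pos[OF j'] jm(3) by simp
      then show "(b (j', i, ?l) \<cdot>\<^sub>v unit_vec N (offset mu j')) $ t =
          (if j' = j then (if m = 0 then b (j, i, ?l) else 0) else 0)"
        using t offset_less[OF j'] by auto
    qed simp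
    also have "\<dots> = (if j < i \<and> m = 0 then b (j, i, ?l) else 0)"
      by (simp add: sum.delta)
    finally have 1: "(\<Sum>j'<i. (b (j', i, ?l) \<cdot>\<^sub>v unit_vec N (offset mu j')) $ t) =
        (if j < i \<and> m = 0 then b (j, i, ?l) else 0)" .
    have 2: "(M *\<^sub>v unit_vec N ?c) $ t = comp_entry mu b (j, m) (i, k)"
      using t c M_carrier comp_mat_index[OF jm(1,2) i k, of b]
      by (simp add: mult_mat_unit_vec[OF M_carrier] jm(3))
    have "t = offset mu i + Suc k \<longleftrightarrow> j = i \<and> m = Suc k"
      using offset_inject[OF jm(1,2) i Suc.prems] jm(3) by simp
    then have 3: "unit_vec N (offset mu i + Suc k) $ t = (if j = i \<and> m = Suc k then 1 else (0 :: complex))"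
      using t c(2) by auto
    have "k \<noteq> mu ! i - 1" using Suc.prems by simp
    then show "(M *\<^sub>v unit_vec N ?c - vec N (\<lambda>t. \<Sum>j<i. (b (j, i, ?l) \<cdot>\<^sub>v unit_vec N (offset mu j)) $ t)) $ t =
        unit_vec N (offset mu i + Suc k) $ t"
      using t M_carrier unfolding 3 by (simp add: 1 2 comp_entry_def del: index_smult_vec index_mult_mat_vec)
  qed simp
  finally show ?case .
qed

lemma phi_v: "r < N \<Longrightarrow> \<phi> (v r) = unit_vec N r"
  by (erule block_index_cases) (simp add: v_offset phi_v_vec)

text \<open>The section of \<open>\<phi>\<close> given by the vectors \<open>v\<close>.\<close>

definition lift :: "complex vec \<Rightarrow> complex poly vec" where
  "lift g = vec n (\<lambda>s. \<Sum>r<N. ([:g $ r:] \<cdot>\<^sub>v v r) $ s)"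

lemma lift_carrier: "lift g \<in> carrier_vec n"
  by (simp add: lift_def)

lemma dim_lift [simp]: "dim_vec (lift g) = n"
  by (simp add: lift_def)

lemma lift_index: "s < n \<Longrightarrow> lift g $ s = (\<Sum>r<N. [:g $ r:] * v r $ s)"
  unfolding lift_def by (auto intro!: sum.cong simp: carrier_vecD[OF v_carrier])

lemma phi_lift:
  assumes g: "g \<in> carrier_vec N"
  shows "\<phi> (lift g) = g"
proof (rule eq_vecI)
  fix t assume "t < dim_vec g"
  then have t: "t < N" using g by simp
  have "\<phi> (lift g) $ t = (\<Sum>r<N. \<phi> ([:g $ r:] \<cdot>\<^sub>v v r) $ t)"
    unfolding lift_def using t by (subst phi_sum) (auto intro: v_carrier)
  also have "\<dots> = (\<Sum>r<N. if r = t then g $ t else 0)"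
    using t by (intro sum.cong) (auto simp: phi_const[OF v_carrier] phi_v)
  finally show "\<phi> (lift g) $ t = g $ t" using t by simp
qed (use g in \<open>simp add: \<phi>_def\<close>)

section \<open>The kernel of the coordinates is the lattice\<close>

lemma mem_lattice: "u \<in> lattice_of A \<longleftrightarrow> (\<exists>f\<in>carrier_vec n. u = A *\<^sub>v f)"
  using A_carrier by (auto simp: lattice_of_def)

lemma lattice_carrier: "u \<in> lattice_of A \<Longrightarrow> u \<in> carrier_vec n"
  using A_carrier by (auto simp: mem_lattice)

lemma lattice_add:
  assumes "u \<in> lattice_of A" "w \<in> lattice_of A"
  shows "u + w \<in> lattice_of A"
proof -
  from assms obtain f g where fg: "f \<in> carrier_vec n" "g \<in> carrier_vec n" "u = A *\<^sub>v f" "w = A *\<^sub>v g"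
    by (auto simp: mem_lattice)
  then have "u + w = A *\<^sub>v (f + g)"
    using mult_add_distrib_mat_vec[OF A_carrier] by simp
  with fg show ?thesis by (auto simp: mem_lattice)
qed

lemma lattice_smult:
  assumes "u \<in> lattice_of A"
  shows "p \<cdot>\<^sub>v u \<in> lattice_of A"
proof -
  from assms obtain f where f: "f \<in> carrier_vec n" "u = A *\<^sub>v f"
    by (auto simp: mem_lattice)
  then have "p \<cdot>\<^sub>v u = A *\<^sub>v (p \<cdot>\<^sub>v f)"
    using A_carrier by (intro eq_vecI) (auto simp: scalar_prod_def sum_distrib_left mult_ac)
  with f show ?thesis by (auto simp: mem_lattice)
qed

lemma zero_in_lattice: "0\<^sub>v n \<in> lattice_of A"
proof -
  have "0\<^sub>v n = A *\<^sub>v 0\<^sub>v n"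
    using A_carrier by (intro eq_vecI) (auto simp: scalar_prod_def)
  then show ?thesis by (auto simp: mem_lattice)
qed

lemma phi_smult_zero:
  assumes f: "f \<in> carrier_vec n" and z: "\<phi> f = 0\<^sub>v N"
  shows "\<phi> (p \<cdot>\<^sub>v f) = 0\<^sub>v N"
proof (induction p)
  case 0
  have "0 \<cdot>\<^sub>v f = 0\<^sub>v n" using f by auto
  then show ?case by (simp add: phi_zero)
next
  case (pCons a p)
  have "pCons a p \<cdot>\<^sub>v f = [:a:] \<cdot>\<^sub>v f + [:0, 1:] \<cdot>\<^sub>v (p \<cdot>\<^sub>v f)"
    using f by (intro eq_vecI) (auto simp: algebra_simps)
  then have "\<phi> (pCons a p \<cdot>\<^sub>v f) = a \<cdot>\<^sub>v 0\<^sub>v N + M *\<^sub>v 0\<^sub>v N"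
    using f pCons.IH z by (simp only: phi_add[OF smult_closed_vec smult_closed_vec[OF smult_closed_vec]]
        phi_const phi_x[OF smult_closed_vec])
  also have "\<dots> = 0\<^sub>v N"
    using M_carrier by (intro eq_vecI) (auto simp: scalar_prod_def)
  finally show ?case .
qed

text \<open>The column is \<open>x v - \<Sum> M v\<close> at the last vector of its block, and \<open>\<phi>\<close> turns multiplication by
  \<open>x\<close> into \<open>M\<close>.\<close>

lemma phi_col:
  assumes i: "i < n"
  shows "\<phi> (col A i) = 0\<^sub>v N"
proof -
  let ?m = "mu ! i - 1"
  let ?c = "offset mu i + ?m"
  have m: "?m < mu ! i" using pos[OF i] by simp
  have c: "?c < N" by (rule block_index_offset(1)[OF i m])
  have "col A i = [:0, 1:] \<cdot>\<^sub>v v ?c - lift (col M ?c)"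
  proof (rule eq_vecI)
    fix s assume "s < dim_vec ([:0, 1:] \<cdot>\<^sub>v v ?c - lift (col M ?c))"
    then have s: "s < n" by (simp add: lift_def)
    have "lift (col M ?c) $ s = (\<Sum>r<N. [:M $$ (r, ?c):] * v r $ s)"
      unfolding lift_index[OF s] using c M_carrier by (intro sum.cong) auto
    then show "col A i $ s = ([:0, 1:] \<cdot>\<^sub>v v ?c - lift (col M ?c)) $ s"
      using x_times_v[OF i m s] s i A_carrier carrier_vecD[OF v_carrier[OF c]]
        carrier_vecD[OF lift_carrier, of "col M ?c"] by simp
  qed (use A_carrier in \<open>simp add: lift_def\<close>)
  then have "\<phi> (col A i) = M *\<^sub>v \<phi> (v ?c) - \<phi> (lift (col M ?c))"
    using c by (simp only: phi_diff[OF smult_closed_vec[OF v_carrier] lift_carrier] phi_x[OF v_carrier])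
  also have "\<phi> (lift (col M ?c)) = col M ?c"
    by (intro phi_lift carrier_vecI) (use M_carrier in simp)
  also have "M *\<^sub>v \<phi> (v ?c) = col M ?c"
    using c by (simp only: phi_v mult_mat_unit_vec[OF M_carrier])
  also have "col M ?c - col M ?c = 0\<^sub>v N"
    using M_carrier by (auto intro!: eq_vecI)
  finally show ?thesis .
qed

lemma phi_lattice:
  assumes "u \<in> lattice_of A"
  shows "\<phi> u = 0\<^sub>v N"
proof -
  from assms obtain f where f: "f \<in> carrier_vec n" "u = A *\<^sub>v f"
    by (auto simp: mem_lattice)
  have "u = vec n (\<lambda>s. \<Sum>i<n. (f $ i \<cdot>\<^sub>v col A i) $ s)"
    unfolding f(2) using f(1) A_carrier
    by (intro eq_vecI) (auto simp: scalar_prod_def atLeast0LessThan mult.commute intro!: sum.cong)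
  also have "\<phi> \<dots> = vec N (\<lambda>t. \<Sum>i<n. \<phi> (f $ i \<cdot>\<^sub>v col A i) $ t)"
    using A_carrier by (intro phi_sum) auto
  also have "\<dots> = 0\<^sub>v N"
  proof (rule eq_vecI)
    fix t assume "t < dim_vec (0\<^sub>v N)"
    then have t: "t < N" by simp
    have "\<phi> (f $ i \<cdot>\<^sub>v col A i) $ t = 0" if "i < n" for i
      using t that A_carrier by (subst phi_smult_zero[OF _ phi_col]) auto
    then show "vec N (\<lambda>t. \<Sum>i<n. \<phi> (f $ i \<cdot>\<^sub>v col A i) $ t) $ t = 0\<^sub>v N $ t"
      using t by simp
  qed simp
  finally show ?thesis .
qed

text \<open>It remains to see that the kernel is not larger than the lattice, that is, that the \<open>v\<close> span the
  quotient. The vectors congruent to their lifted coordinates form a \<open>\<complex>[x]\<close>-submodule containing the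
  standard basis, hence are all vectors.\<close>

definition reduces :: "complex poly vec \<Rightarrow> bool" where
  "reduces f \<longleftrightarrow> f - lift (\<phi> f) \<in> lattice_of A"

lemma reduces_add:
  assumes "f \<in> carrier_vec n" "g \<in> carrier_vec n" "reduces f" "reduces g"
  shows "reduces (f + g)"
proof -
  have "lift (\<phi> f + \<phi> g) = lift (\<phi> f) + lift (\<phi> g)"
  proof (rule eq_vecI)
    fix s assume "s < dim_vec (lift (\<phi> f) + lift (\<phi> g))"
    then have s: "s < n" by (simp add: lift_def)
    have "[:(\<phi> f + \<phi> g) $ r:] * v r $ s = [:\<phi> f $ r:] * v r $ s + [:\<phi> g $ r:] * v r $ s" if "r < N" for r
    proof -
      have "[:(\<phi> f + \<phi> g) $ r:] = [:\<phi> f $ r:] + [:\<phi> g $ r:]"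
        using that phi_closed[of f] phi_closed[of g] by simp
      then show ?thesis by (simp only: distrib_right)
    qed
    then show "lift (\<phi> f + \<phi> g) $ s = (lift (\<phi> f) + lift (\<phi> g)) $ s"
      using s carrier_vecD[OF lift_carrier] by (simp add: lift_index sum.distrib)
  qed (simp add: lift_def)
  then have "f + g - lift (\<phi> (f + g)) = (f - lift (\<phi> f)) + (g - lift (\<phi> g))"
    using assms(1,2) lift_carrier by (auto simp: phi_add intro!: eq_vecI)
  then show ?thesis
    using lattice_add assms(3,4) by (simp add: reduces_def)
qed

lemma reduces_const:
  assumes "f \<in> carrier_vec n" "reduces f"
  shows "reduces ([:c:] \<cdot>\<^sub>v f)"
proof -
  have "lift (c \<cdot>\<^sub>v \<phi> f) = [:c:] \<cdot>\<^sub>v lift (\<phi> f)"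
  proof (rule eq_vecI)
    fix s assume "s < dim_vec ([:c:] \<cdot>\<^sub>v lift (\<phi> f))"
    then have s: "s < n" by (simp add: lift_def)
    have "[:(c \<cdot>\<^sub>v \<phi> f) $ r:] * v r $ s = [:c:] * ([:\<phi> f $ r:] * v r $ s)" if "r < N" for r
    proof -
      have "[:(c \<cdot>\<^sub>v \<phi> f) $ r:] = [:c:] * [:\<phi> f $ r:]"
        using that phi_closed[of f] by simp
      then show ?thesis by (simp only: mult.assoc)
    qed
    then have "lift (c \<cdot>\<^sub>v \<phi> f) $ s = (\<Sum>r<N. [:c:] * ([:\<phi> f $ r:] * v r $ s))"
      unfolding lift_index[OF s] by (intro sum.cong) auto
    then show "lift (c \<cdot>\<^sub>v \<phi> f) $ s = ([:c:] \<cdot>\<^sub>v lift (\<phi> f)) $ s"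
      using s by (simp only: sum_distrib_left[symmetric] lift_index[OF s, symmetric] index_smult_vec dim_lift)
  qed (simp add: lift_def)
  then have "[:c:] \<cdot>\<^sub>v f - lift (\<phi> ([:c:] \<cdot>\<^sub>v f)) = [:c:] \<cdot>\<^sub>v (f - lift (\<phi> f))"
    using assms(1) carrier_vecD[OF lift_carrier, of "\<phi> f"]
    by (auto simp: phi_const right_diff_distrib smult_diff_right intro!: eq_vecI)
  then show ?thesis
    using lattice_smult assms(2) by (simp add: reduces_def)
qed

text \<open>By the relations for \<open>x v\<close>, the difference is the combination of the columns of \<open>A\<close> whose
  coefficients are the coordinates at the last positions of the blocks.\<close>

lemma x_times_lift:
  assumes g: "g \<in> carrier_vec N"
  shows "[:0, 1:] \<cdot>\<^sub>v lift g - lift (M *\<^sub>v g) \<in> lattice_of A"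
proof -
  let ?h = "vec n (\<lambda>i. [:g $ (offset mu i + (mu ! i - 1)):])"
  have "[:0, 1:] \<cdot>\<^sub>v lift g - lift (M *\<^sub>v g) = A *\<^sub>v ?h"
  proof (rule eq_vecI)
    fix s assume "s < dim_vec (A *\<^sub>v ?h)"
    then have s: "s < n" using A_carrier by simp
    have "lift (M *\<^sub>v g) $ s = (\<Sum>r<N. [:\<Sum>c<N. M $$ (r, c) * g $ c:] * v r $ s)"
      unfolding lift_index[OF s] using g M_carrier
      by (intro sum.cong) (auto simp: scalar_prod_def atLeast0LessThan)
    also have "\<dots> = (\<Sum>r<N. \<Sum>c<N. [:g $ c:] * ([:M $$ (r, c):] * v r $ s))"
    proof (rule sum.cong)
      fix r
      have "[:M $$ (r, c) * g $ c:] * v r $ s = [:g $ c:] * ([:M $$ (r, c):] * v r $ s)" for c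
        by (simp add: mult.commute)
      then show "[:\<Sum>c<N. M $$ (r, c) * g $ c:] * v r $ s = (\<Sum>c<N. [:g $ c:] * ([:M $$ (r, c):] * v r $ s))"
        by (simp only: const_poly_sum sum_distrib_right)
    qed simp
    also have "\<dots> = (\<Sum>c<N. [:g $ c:] * (\<Sum>r<N. [:M $$ (r, c):] * v r $ s))"
      by (subst sum.swap) (simp only: sum_distrib_left)
    finally have "[:0, 1:] * lift g $ s - lift (M *\<^sub>v g) $ s =
        (\<Sum>c<N. [:g $ c:] * ([:0, 1:] * v c $ s - (\<Sum>r<N. [:M $$ (r, c):] * v r $ s)))"
      unfolding lift_index[OF s]
      by (simp only: sum_distrib_left right_diff_distrib sum_subtractf mult.left_commute)
    also have "\<dots> = (\<Sum>i<n. \<Sum>m<mu ! i. [:g $ (offset mu i + m):] * (if m = mu ! i - 1 then A $$ (s, i) else 0))"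
      by (subst sum_block_index, intro sum.cong refl) (simp only: lessThan_iff x_times_v s)
    also have "\<dots> = (\<Sum>i<n. A $$ (s, i) * [:g $ (offset mu i + (mu ! i - 1)):])"
    proof (intro sum.cong refl)
      fix i assume "i \<in> {..<n}"
      then have "mu ! i - 1 < mu ! i" using pos[of i] by simp
      then have "A $$ (s, i) * [:g $ (offset mu i + (mu ! i - 1)):] =
          (\<Sum>m<mu ! i. if m = mu ! i - 1 then A $$ (s, i) * [:g $ (offset mu i + m):] else 0)"
        by (subst sum.delta) auto
      also have "\<dots> = (\<Sum>m<mu ! i. [:g $ (offset mu i + m):] * (if m = mu ! i - 1 then A $$ (s, i) else 0))"
        by (intro sum.cong refl) (simp split: if_split)
      finally show "(\<Sum>m<mu ! i. [:g $ (offset mu i + m):] * (if m = mu ! i - 1 then A $$ (s, i) else 0)) =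
          A $$ (s, i) * [:g $ (offset mu i + (mu ! i - 1)):]" ..
    qed
    finally show "([:0, 1:] \<cdot>\<^sub>v lift g - lift (M *\<^sub>v g)) $ s = (A *\<^sub>v ?h) $ s"
      using s A_carrier carrier_vecD[OF lift_carrier]
      by (simp add: scalar_prod_def atLeast0LessThan del: mult_pCons_left mult_pCons_right)
  qed (use A_carrier in \<open>simp add: lift_def\<close>)
  then show ?thesis by (auto simp: mem_lattice)
qed

lemma reduces_x:
  assumes f: "f \<in> carrier_vec n" "reduces f"
  shows "reduces ([:0, 1:] \<cdot>\<^sub>v f)"
proof -
  have "[:0, 1:] \<cdot>\<^sub>v f - lift (\<phi> ([:0, 1:] \<cdot>\<^sub>v f)) =
      [:0, 1:] \<cdot>\<^sub>v (f - lift (\<phi> f)) + ([:0, 1:] \<cdot>\<^sub>v lift (\<phi> f) - lift (M *\<^sub>v \<phi> f))"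
    using f(1) carrier_vecD[OF lift_carrier]
    by (intro eq_vecI) (auto simp: phi_x algebra_simps simp del: mult_pCons_left mult_pCons_right)
  then show ?thesis
    using lattice_add[OF lattice_smult x_times_lift[OF phi_closed]] f(2) by (simp add: reduces_def)
qed

lemma reduces_unit:
  assumes i: "i < n"
  shows "reduces (unit_vec n i)"
proof -
  have o: "offset mu i < N" by (rule offset_less[OF i])
  have vo: "v (offset mu i) = unit_vec n i"
    using v_offset[OF i, of 0] pos[OF i] by simp
  have "lift (unit_vec N (offset mu i)) = unit_vec n i"
  proof (rule eq_vecI)
    fix s assume "s < dim_vec (unit_vec n i :: complex poly vec)"
    then have s: "s < n" by simp
    have "lift (unit_vec N (offset mu i)) $ s = (\<Sum>r<N. if r = offset mu i then v r $ s else 0)"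
      unfolding lift_index[OF s] using o by (intro sum.cong) auto
    then show "lift (unit_vec N (offset mu i)) $ s = unit_vec n i $ s"
      using o vo by simp
  qed (simp add: lift_def)
  then have "unit_vec n i - lift (\<phi> (unit_vec n i)) = 0\<^sub>v n"
    by (simp add: phi_unit[OF i])
  then show ?thesis
    by (simp add: reduces_def zero_in_lattice)
qed

lemma reduces_smult:
  assumes f: "f \<in> carrier_vec n" "reduces f"
  shows "reduces (p \<cdot>\<^sub>v f)"
proof (induction p)
  case 0
  have "0 \<cdot>\<^sub>v f = [:0:] \<cdot>\<^sub>v f" by simp
  then show ?case using reduces_const[OF f, of 0] by simp
next
  case (pCons a p)
  have "pCons a p \<cdot>\<^sub>v f = [:a:] \<cdot>\<^sub>v f + [:0, 1:] \<cdot>\<^sub>v (p \<cdot>\<^sub>v f)"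
    using f by (intro eq_vecI) (auto simp: algebra_simps)
  then show ?case
    using f pCons.IH by (simp only:) (intro reduces_add reduces_const reduces_x smult_closed_vec)
qed

lemma reduces_all:
  assumes f: "f \<in> carrier_vec n"
  shows "reduces f"
proof -
  have "reduces f" if "m \<le> n" "f \<in> carrier_vec n" "\<And>i. m \<le> i \<Longrightarrow> i < n \<Longrightarrow> f $ i = 0" for m and f :: "complex poly vec"
    using that
  proof (induction m arbitrary: f)
    case 0
    then have "f = 0\<^sub>v n" by auto
    moreover have "lift (0\<^sub>v N) = 0\<^sub>v n"
      by (auto simp: lift_def carrier_vecD[OF v_carrier] intro!: eq_vecI)
    ultimately have "f - lift (\<phi> f) = 0\<^sub>v n" by (simp add: phi_zero)
    then show ?case by (simp add: reduces_def zero_in_lattice)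
  next
    case (Suc m)
    let ?g = "vec n (\<lambda>i. if i = m then 0 else f $ i)"
    have "f = ?g + f $ m \<cdot>\<^sub>v unit_vec n m"
      using Suc.prems by (intro eq_vecI) auto
    moreover have "reduces ?g"
      using Suc.prems by (intro Suc.IH) auto
    moreover have "reduces (f $ m \<cdot>\<^sub>v unit_vec n m)"
      using Suc.prems by (intro reduces_smult reduces_unit) auto
    ultimately show ?case
      using reduces_add[of ?g "f $ m \<cdot>\<^sub>v unit_vec n m"] by simp
  qed
  from this[of n f] f show ?thesis by simp
qed

lemma phi_kernel:
  assumes f: "f \<in> carrier_vec n"
  shows "\<phi> f = 0\<^sub>v N \<longleftrightarrow> f \<in> lattice_of A"
proof
  assume "\<phi> f = 0\<^sub>v N"
  moreover have "lift (0\<^sub>v N) = 0\<^sub>v n"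
    by (auto simp: lift_def carrier_vecD[OF v_carrier] intro!: eq_vecI)
  moreover have "f - 0\<^sub>v n = f" using f by auto
  ultimately show "f \<in> lattice_of A"
    using reduces_all[OF f] by (simp add: reduces_def)
qed (rule phi_lattice)

section \<open>The quotient as a coordinate space\<close>

lemma coset_of_eq:
  assumes u: "u \<in> carrier_vec n"
  shows "coset_of A u = {w \<in> carrier_vec n. \<phi> w = \<phi> u}"
proof -
  have "coset_of A u = {h + u | h. h \<in> lattice_of A}"
    using A_carrier by (auto simp: coset_of_def a_r_coset_def' module_vec_simps)
  also have "\<dots> = {w \<in> carrier_vec n. \<phi> w = \<phi> u}"
  proof (intro equalityI subsetI)
    fix w assume "w \<in> {h + u | h. h \<in> lattice_of A}"
    then obtain h where "h \<in> lattice_of A" "w = h + u" by blast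
    then show "w \<in> {w \<in> carrier_vec n. \<phi> w = \<phi> u}"
      using lattice_carrier[of h] phi_lattice[of h] u phi_closed[of u] by (simp add: phi_add)
  next
    fix w assume "w \<in> {w \<in> carrier_vec n. \<phi> w = \<phi> u}"
    then have w: "w \<in> carrier_vec n" "\<phi> w = \<phi> u" by auto
    then have "\<phi> (w - u) = 0\<^sub>v N"
      using u phi_closed[of u] by (simp add: phi_diff)
    then have "w - u \<in> lattice_of A"
      using phi_kernel[of "w - u"] w u by simp
    moreover have "w = (w - u) + u" using w u by auto
    ultimately show "w \<in> {h + u | h. h \<in> lattice_of A}" by blast
  qed
  finally show ?thesis .
qed

lemma coset_of_cong: "u \<in> carrier_vec n \<Longrightarrow> w \<in> carrier_vec n \<Longrightarrow> \<phi> u = \<phi> w \<Longrightarrow> coset_of A u = coset_of A w"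
  by (simp add: coset_of_eq)

lemma quot_carrier: "carrier (quot_space A) = coset_of A ` carrier_vec n"
  using A_carrier by (auto simp: quot_space_def A_RCOSETS_def' coset_of_def module_vec_simps)

lemma quot_zero: "\<zero>\<^bsub>quot_space A\<^esub> = coset_of A (0\<^sub>v n)"
proof -
  have "lattice_of A = coset_of A (0\<^sub>v n)"
    using phi_kernel lattice_carrier by (auto simp: coset_of_eq phi_zero)
  then show ?thesis by (simp add: quot_space_def)
qed

lemma quot_add:
  assumes u: "u \<in> carrier_vec n" and w: "w \<in> carrier_vec n"
  shows "coset_of A u \<oplus>\<^bsub>quot_space A\<^esub> coset_of A w = coset_of A (u + w)"
proof -
  have "coset_of A u \<oplus>\<^bsub>quot_space A\<^esub> coset_of A w = {p + q | p q. p \<in> coset_of A u \<and> q \<in> coset_of A w}"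
    using A_carrier by (auto simp: quot_space_def set_add_def' module_vec_simps)
  also have "\<dots> = coset_of A (u + w)"
  proof (intro equalityI subsetI)
    fix y assume "y \<in> {p + q | p q. p \<in> coset_of A u \<and> q \<in> coset_of A w}"
    then show "y \<in> coset_of A (u + w)"
      using u w by (auto simp: coset_of_eq phi_add)
  next
    fix y assume "y \<in> coset_of A (u + w)"
    then have y: "y \<in> carrier_vec n" "\<phi> y = \<phi> u + \<phi> w"
      using u w by (auto simp: coset_of_eq phi_add)
    have "\<phi> (y - u) = \<phi> u + \<phi> w - \<phi> u"
      using y u by (simp add: phi_diff)
    also have "\<dots> = \<phi> w"
      using phi_closed[of u] phi_closed[of w] by auto
    finally have "y - u \<in> coset_of A w"
      using y u w by (simp add: coset_of_eq)
    moreover have "u \<in> coset_of A u" using u by (simp add: coset_of_eq)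
    moreover have "y = u + (y - u)" using y u by auto
    ultimately show "y \<in> {p + q | p q. p \<in> coset_of A u \<and> q \<in> coset_of A w}" by blast
  qed
  finally show ?thesis .
qed

lemma quot_smult:
  assumes u: "u \<in> carrier_vec n"
  shows "c \<odot>\<^bsub>quot_space A\<^esub> coset_of A u = coset_of A ([:c:] \<cdot>\<^sub>v u)"
proof -
  have "coset_of A ([:c:] \<cdot>\<^sub>v w) = coset_of A ([:c:] \<cdot>\<^sub>v u)" if "w \<in> coset_of A u" for w
    using that u by (intro coset_of_cong) (auto simp: coset_of_eq phi_const)
  moreover have "u \<in> coset_of A u" using u by (simp add: coset_of_eq)
  ultimately have "(\<Union>w\<in>coset_of A u. coset_of A ([:c:] \<cdot>\<^sub>v w)) = coset_of A ([:c:] \<cdot>\<^sub>v u)"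
    by (intro SUP_eq_const) blast+
  then show ?thesis by (simp add: quot_space_def)
qed

lemma mult_x_coset:
  assumes u: "u \<in> carrier_vec n"
  shows "mult_x A (coset_of A u) = coset_of A ([:0, 1:] \<cdot>\<^sub>v u)"
proof -
  have "coset_of A ([:0, 1:] \<cdot>\<^sub>v w) = coset_of A ([:0, 1:] \<cdot>\<^sub>v u)" if "w \<in> coset_of A u" for w
    using that u by (intro coset_of_cong) (auto simp: coset_of_eq phi_x)
  moreover have "u \<in> coset_of A u" using u by (simp add: coset_of_eq)
  ultimately show ?thesis
    unfolding mult_x_def by (intro SUP_eq_const) blast+
qed

text \<open>Since \<open>\<phi>\<close> is constant on cosets, its image of a coset is a singleton.\<close>

definition coset_coord :: "complex poly vec set \<Rightarrow> complex vec" where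
  "coset_coord X = the_elem (\<phi> ` X)"

lemma coset_coord_coset_of:
  assumes u: "u \<in> carrier_vec n"
  shows "coset_coord (coset_of A u) = \<phi> u"
proof -
  have "\<phi> ` coset_of A u = {\<phi> u}"
    using u by (auto simp: coset_of_eq)
  then show ?thesis by (simp add: coset_coord_def)
qed

sublocale coordinates "quot_space A" N coset_coord
proof
  show "bij_betw coset_coord (carrier (quot_space A)) (carrier_vec N)"
    unfolding bij_betw_def
  proof
    show "inj_on coset_coord (carrier (quot_space A))"
    proof (rule inj_onI)
      fix X Y assume X: "X \<in> carrier (quot_space A)" and Y: "Y \<in> carrier (quot_space A)"
        and eq: "coset_coord X = coset_coord Y"
      obtain u where u: "u \<in> carrier_vec n" "X = coset_of A u" using X by (auto simp: quot_carrier)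
      obtain w where w: "w \<in> carrier_vec n" "Y = coset_of A w" using Y by (auto simp: quot_carrier)
      show "X = Y"
        using eq coset_of_cong[OF u(1) w(1)] by (simp add: u w coset_coord_coset_of)
    qed
    show "coset_coord ` carrier (quot_space A) = carrier_vec N"
    proof (intro equalityI subsetI)
      fix g :: "complex vec" assume "g \<in> carrier_vec N"
      then have "g = coset_coord (coset_of A (lift g))"
        by (simp add: coset_coord_coset_of lift_carrier phi_lift)
      then show "g \<in> coset_coord ` carrier (quot_space A)"
        using lift_carrier by (auto simp: quot_carrier)
    qed (auto simp: quot_carrier coset_coord_coset_of phi_closed)
  qed
qed (auto simp: quot_carrier quot_zero quot_add quot_smult coset_coord_coset_of phi_zero phi_add phi_const)

lemma mult_x_closed: "X \<in> carrier (quot_space A) \<Longrightarrow> mult_x A X \<in> carrier (quot_space A)"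
  by (auto simp: quot_carrier mult_x_coset)

lemma coset_coord_mult_x:
  "X \<in> carrier (quot_space A) \<Longrightarrow> coset_coord (mult_x A X) = M *\<^sub>v coset_coord X"
  by (auto simp: quot_carrier mult_x_coset coset_coord_coset_of phi_x)

lemma quot_basis_carrier: "set (quot_basis mu A) \<subseteq> carrier (quot_space A)"
  by (auto simp: quot_basis_def quot_carrier v_list_eq_map v_vec_carrier)

lemma length_quot_basis: "length (quot_basis mu A) = N"
  by (simp add: quot_basis_def length_v_list)

lemma quot_basis_coords: "mat_of_cols N (map coset_coord (quot_basis mu A)) = 1\<^sub>m N"
proof (rule eq_matI)
  fix r c assume "r < dim_row (1\<^sub>m N :: complex mat)" "c < dim_col (1\<^sub>m N :: complex mat)"
  then show "mat_of_cols N (map coset_coord (quot_basis mu A)) $$ (r, c) = 1\<^sub>m N $$ (r, c)"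
    by (simp add: mat_of_cols_index quot_basis_def length_v_list coset_coord_coset_of v_carrier phi_v)
qed (simp_all add: length_quot_basis)

lemma quot_basis_is_basis: "ordered_basis (quot_space A) (quot_basis mu A)"
  by (simp add: ordered_basis_iff quot_basis_carrier length_quot_basis quot_basis_coords)

lemma quot_basis_matrix_iff: "is_matrix_of (quot_space A) (quot_basis mu A) (mult_x A) K \<longleftrightarrow> K = M"
  using M_carrier
  by (auto simp: is_matrix_of_iff[OF quot_basis_carrier length_quot_basis mult_x_closed M_carrier
        coset_coord_mult_x] quot_basis_coords)

lemma MVy_eq: "MVy mu A = M"
  by (simp add: MVy_def quot_basis_matrix_iff)

lemma mult_x_jordan_nf_iff:
  "operator_jordan_nf (quot_space A) (mult_x A) n_as \<longleftrightarrow> jordan_nf M n_as"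
  by (rule operator_jordan_nf_iff[OF mult_x_closed M_carrier coset_coord_mult_x])

end

section \<open>The isomorphism\<close>


theorem mainTheorem5:
  fixes mu :: "nat list"
  assumes "\<forall>i < length mu. 1 \<le> mu ! i"
  shows "(\<forall>A \<in> W_slice mu.
            ordered_basis (quot_space A) (quot_basis mu A) \<and>
            is_matrix_of (quot_space A) (quot_basis mu A) (mult_x A) (MVy mu A)) \<and>
         variety_isomorphism poly_mat_coords (W_slice mu) mat_coords (S_slice mu) (MVy mu) \<and>
         (\<forall>A \<in> W_slice mu. \<forall>n_as.
            operator_jordan_nf (quot_space A) (mult_x A) n_as \<longleftrightarrow> jordan_nf (MVy mu A) n_as)"
proof -
  have pos: "1 \<le> mu ! i" if "i < length mu" for i
    using assms that by blast
  have point: "ordered_basis (quot_space A) (quot_basis mu A) \<and>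
      is_matrix_of (quot_space A) (quot_basis mu A) (mult_x A) (MVy mu A) \<and>
      (\<forall>n_as. operator_jordan_nf (quot_space A) (mult_x A) n_as \<longleftrightarrow> jordan_nf (MVy mu A) n_as) \<and>
      MVy mu A = comp_mat mu (b_param mu A)"
    if A: "A \<in> W_slice mu" for A
  proof -
    interpret slice_point mu "b_param mu A"
      by unfold_locales (rule pos, assumption, rule b_param_in_param_space)
    show ?thesis
      using quot_basis_is_basis quot_basis_matrix_iff MVy_eq mult_x_jordan_nf_iff
      unfolding slice_mat_b_param[OF A] by simp
  qed
  have "variety_isomorphism poly_mat_coords (W_slice mu) mat_coords (S_slice mu) (MVy mu)"
    by (rule polynomial_chart_isomorphism[OF slice_mat_polynomial_chart comp_mat_polynomial_chart])
       (use pos point in blast)+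
  with point show ?thesis by blast
qed

end
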